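(* Let $X \subseteq PVar$ be such that $PVar \setminus X$ is countably infinite. Then an arbitrary $\Gamma \subseteq Form_X$ is consistent if and only if it is satisfiable in a normal jstit model (i.e. there are a normal jstit model $\mathcal{M}$ and $(m,h) \in MH(\mathcal{M})$ such that $\mathcal{M},m,h\models A$ for all $A\in\Gamma$).
   Context: Language. $Ag$ is a fixed finite set of agents; $PVar$, $PConst$, $Var$ are countably infinite, pairwise disjoint sets of proof variables, proof constants and propositional variables. Proof polynomials ($Pol$): $t ::= x \mid c \mid s+t \mid s\times t \mid\, !t$ with $x\in PVar$, $c\in PConst$. Formulas ($Form$): $A ::= p \mid A\wedge B\mid \neg A\mid [j]A\mid \Box A\mid t{:}A\mid KA\mid Prove(j,A)\mid Proven(A)$ with $p\in Var$, $j\in Ag$, $t\in Pol$. Other Boolean connectives and $\bot$ are the usual abbreviations; $\Diamond,\langle K\rangle,\langle j\rangle$ are the duals of $\Box,K,[j]$. For $Z\subseteq PVar$, $Pol_Z$ and $Form_Z$ are the sets of proof polynomials, resp. formulas, all of whose proof variables belong to $Z$ (no restriction on proof constants). Axiom schemes. (A0) a full set of axioms for classical propositional logic; (A1) S5 axioms for $\Box$ and for each $[j]$; (A2) $\Box A\to[j]A$; (A3) $(\Diamond[j_1]A_1\wedge\ldots\wedge\Diamond[j_n]A_n)\to\Diamond([j_1]A_1\wedge\ldots\wedge[j_n]A_n)$ for pairwise different $j_1,\ldots,j_n$; (A4) $s{:}(A\to B)\to(t{:}A\to(s\times t){:}B)$; (A5) $t{:}A\to(!t{:}(t{:}A)\wedge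 KA)$; (A6) $(s{:}A\vee t{:}A)\to(s+t){:}A$; (A7) S4 axioms for $K$; (A8) $KA\to\Box K\Box A$; (A9) $Prove(j,A)\to(\neg Proven(A)\wedge[j]Prove(j,A)\wedge KA)$; (A10) $\Box Prove(j,A)\to\Box Prove(i,A)$; (A11) $Proven(A)\to(KProven(A)\wedge KA)$; (A12) $\neg K(\bigvee_{l=1}^n\langle K\rangle\Diamond Prove(j_l,A_l))$, $n\geq 1$; (A13) $\neg Prove(j,A)\to\langle j\rangle\bigwedge_{i\in Ag}\neg Prove(i,A)$. Rules. (R1) from $A$, $A\to B$ infer $B$; (R2) from $A$ infer $KA$; (R3) if $A$ is an instance of (A0)--(A13) and $c\in PConst$, infer $c{:}A$; (R4) from $KA\to(\neg Proven(B_1)\vee\ldots\vee\neg Proven(B_n))$ infer $KA\to(\bigwedge_{j\in Ag}\neg Prove(j,B_1)\vee\ldots\vee\bigwedge_{j\in Ag}\neg Prove(j,B_n))$. $\vdash A$ means that $A$ is the last formula of a finite sequence of formulas each of which is an axiom or follows from earlier ones by a rule. A set $\Gamma$ of formulas is inconsistent iff $\vdash(A_1\wedge\ldots\wedge A_n)\to\bot$ for some $A_1,\ldots,A_n\in\Gamma$; otherwise it is consistent. Models. A jstit model is $\mathcal{M}=\langle Tree,\leq,Choice,Act,R,\mathcal{E},V\rangle$ where $Tree\neq\emptyset$ (moments); $\leq$ is a partial order on $Tree$ ($<$ its strict part); $Hist$ is the set of maximal $\leq$-chains (histories), $H_m=\{h\in Hist\mid m\in h\}$, $MH(\mathcal{M})=\{(m,h)\mid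 m\in Tree,h\in H_m\}$; $Choice$ assigns to each $m\in Tree$, $j\in Ag$ a partition $Choice^m_j$ of $H_m$, $Choice^m_j(h)$ being the cell containing $h$; $Act:MH(\mathcal{M})\to 2^{Pol}$; $R$ is a preorder on $Tree$; $\mathcal{E}:Tree\times Pol\to 2^{Form}$; $V:Var\to 2^{MH(\mathcal{M})}$; and for all $m,m',m_1,m_2 \in Tree$, $j\in Ag$, $s,t\in Pol$, $A,B\in Form$: 1. any two moments have a common $\leq$-lower bound; 2. if $m_1\leq m$ and $m_2\leq m$ then $m_1\leq m_2$ or $m_2\leq m_1$; 3. if $h,h'\in H_m$, $m<m'$ and $m'\in h\cap h'$, then $Choice^m_j(h)=Choice^m_j(h')$; 4. if $f(j)\in Choice^m_j$ for all $j\in Ag$, then $\bigcap_{j\in Ag}f(j)\neq\emptyset$; 5. $R(m,m')$ implies $\mathcal{E}(m,t)\subseteq\mathcal{E}(m',t)$; 6. (a) $A\to B\in\mathcal{E}(m,s)$ and $A\in\mathcal{E}(m,t)$ imply $B\in\mathcal{E}(m,s\times t)$; (b) $\mathcal{E}(m,s)\cup\mathcal{E}(m,t)\subseteq\mathcal{E}(m,s+t)$; (c) $A\in\mathcal{E}(m,t)$ implies $t{:}A\in\mathcal{E}(m,!t)$; 7. $m'<m$ implies $Act(m',h)\subseteq Act(m,h)$ for all $h\in H_m$; 8. $\bigcap_{h\in H_m}Act(m,h)\subseteq\bigcup_{m'<m,\,h\in H_m}Act(m',h)$; 9. if $h,h'\in H_m$ and some $m'>m$ lies in $h\cap h'$,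 then $Act(m,h)=Act(m,h')$; 10. $\leq\,\subseteq R$; 11. $R(m,m')$ implies $\bigcap_{h\in H_m}Act(m,h)\subseteq\bigcap_{h'\in H_{m'}}Act(m',h')$. The model is normal iff for every $c\in PConst$ and $m\in Tree$, every instance of (A0)--(A13) is in $\mathcal{E}(m,c)$. Satisfaction at $(m,h)\in MH(\mathcal{M})$ (Boolean clauses standard): $p$ iff $(m,h)\in V(p)$; $[j]A$ iff $\mathcal{M},m,h'\models A$ for all $h'\in Choice^m_j(h)$; $\Box A$ iff $\mathcal{M},m,h'\models A$ for all $h'\in H_m$; $KA$ iff $\mathcal{M},m',h'\models A$ for all $m'$ with $R(m,m')$ and all $h'\in H_{m'}$; $t{:}A$ iff $A\in\mathcal{E}(m,t)$ and $\mathcal{M},m,h\models KA$; $Prove(j,A)$ iff (for all $h'\in Choice^m_j(h)$ there is $t\in Act(m,h')$ with $\mathcal{M},m,h'\models t{:}A$) and (for every $s\in Pol$ there is $h''\in H_m$ such that $\mathcal{M},m,h\models s{:}A$ implies $s\notin Act(m,h'')$); $Proven(A)$ iff there is $t\in Pol$ such that for all $h'\in H_m$, $t\in Act(m,h')$ and $\mathcal{M},m,h\models t{:}A$. *)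

theory Defs
  imports "HOL-Library.Disjoint_Sets" "HOL-Library.Countable_Set"
begin

section \<open>Language\<close>

text \<open>
  The agents are the elements of a finite type (variable \<open>'ag\<close> of class \<open>finite\<close>). The three
  countably infinite alphabets are copies of the natural numbers; they are kept apart by the
  constructors of the two datatypes.
\<close>

type_synonym pvar = nat
type_synonym pconst = nat
type_synonym propvar = nat

datatype pol =
    PVar pvar
  | PConst pconst
  | PSum pol pol      (infixl \<open>\<^bold>+\<close> 75)
  | PProd pol pol     (infixl \<open>\<^bold>\<times>\<close> 76)
  | PBang pol         (\<open>\<^bold>! _\<close> [80] 80)

datatype 'ag form =
    Atom propvar
  | Conj "'ag form" "'ag form"    (infixr \<open>\<^bold>\<and>\<close> 55)
  | Neg "'ag form"                (\<open>\<^bold>\<not> _\<close> [60] 60)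
  | Stit 'ag "'ag form"           (\<open>\<^bold>[_\<^bold>] _\<close> [0, 60] 60)
  | Box "'ag form"                (\<open>\<^bold>\<box> _\<close> [60] 60)
  | Just pol "'ag form"           (infixr \<open>\<^bold>:\<close> 70)
  | Know "'ag form"               (\<open>\<^bold>K _\<close> [60] 60)
  | Prove 'ag "'ag form"
  | Proven "'ag form"

abbreviation Disj :: "'ag form \<Rightarrow> 'ag form \<Rightarrow> 'ag form"  (infixr \<open>\<^bold>\<or>\<close> 52)
  where "A \<^bold>\<or> B \<equiv> \<^bold>\<not> (\<^bold>\<not> A \<^bold>\<and> \<^bold>\<not> B)"

abbreviation Imp :: "'ag form \<Rightarrow> 'ag form \<Rightarrow> 'ag form"  (infixr \<open>\<^bold>\<rightarrow>\<close> 51)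
  where "A \<^bold>\<rightarrow> B \<equiv> \<^bold>\<not> (A \<^bold>\<and> \<^bold>\<not> B)"

definition Bot :: "'ag form"  (\<open>\<^bold>\<bottom>\<close>)
  where "\<^bold>\<bottom> = Atom 0 \<^bold>\<and> \<^bold>\<not> Atom 0"

abbreviation Top :: "'ag form"  (\<open>\<^bold>\<top>\<close>)
  where "\<^bold>\<top> \<equiv> \<^bold>\<not> \<^bold>\<bottom>"

abbreviation Dia :: "'ag form \<Rightarrow> 'ag form"  (\<open>\<^bold>\<diamond> _\<close> [60] 60)
  where "\<^bold>\<diamond> A \<equiv> \<^bold>\<not> \<^bold>\<box> \<^bold>\<not> A"

abbreviation DKnow :: "'ag form \<Rightarrow> 'ag form"  (\<open>\<^bold>\<langle>\<^bold>K\<^bold>\<rangle> _\<close> [60] 60)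
  where "\<^bold>\<langle>\<^bold>K\<^bold>\<rangle> A \<equiv> \<^bold>\<not> \<^bold>K \<^bold>\<not> A"

abbreviation DStit :: "'ag \<Rightarrow> 'ag form \<Rightarrow> 'ag form"  (\<open>\<^bold>\<langle>_\<^bold>\<rangle> _\<close> [0, 60] 60)
  where "\<^bold>\<langle>j\<^bold>\<rangle> A \<equiv> \<^bold>\<not> \<^bold>[j\<^bold>] \<^bold>\<not> A"

fun Conjs :: "'ag form list \<Rightarrow> 'ag form" where
  "Conjs [] = \<^bold>\<top>"
| "Conjs [A] = A"
| "Conjs (A # B # As) = A \<^bold>\<and> Conjs (B # As)"

fun Disjs :: "'ag form list \<Rightarrow> 'ag form" where
  "Disjs [] = \<^bold>\<bottom>"
| "Disjs [A] = A"
| "Disjs (A # B # As) = A \<^bold>\<or> Disjs (B # As)"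

text \<open>A conjunction over all agents needs some order of the conjuncts; which one is immaterial.\<close>

definition agents :: "'ag::finite list"
  where "agents = (SOME js. distinct js \<and> set js = UNIV)"

lemma agents: "distinct (agents :: 'ag::finite list)" "set (agents :: 'ag::finite list) = UNIV"
proof -
  have "\<exists>js :: 'ag list. distinct js \<and> set js = UNIV"
    using finite_distinct_list[OF finite_UNIV] by blast
  then have "distinct (agents :: 'ag list) \<and> set (agents :: 'ag list) = UNIV"
    unfolding agents_def by (rule someI_ex)
  then show "distinct (agents :: 'ag list)" "set (agents :: 'ag list) = UNIV"
    by auto
qed

definition NobodyProves :: "'ag::finite form \<Rightarrow> 'ag form"
  where "NobodyProves A = Conjs (map (\<lambda>j. \<^bold>\<not> Prove j A) agents)"

primrec pvars_pol :: "pol \<Rightarrow> pvar set" where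
  "pvars_pol (PVar x) = {x}"
| "pvars_pol (PConst c) = {}"
| "pvars_pol (s \<^bold>+ t) = pvars_pol s \<union> pvars_pol t"
| "pvars_pol (s \<^bold>\<times> t) = pvars_pol s \<union> pvars_pol t"
| "pvars_pol (\<^bold>! t) = pvars_pol t"

primrec pvars :: "'ag form \<Rightarrow> pvar set" where
  "pvars (Atom p) = {}"
| "pvars (A \<^bold>\<and> B) = pvars A \<union> pvars B"
| "pvars (\<^bold>\<not> A) = pvars A"
| "pvars (\<^bold>[j\<^bold>] A) = pvars A"
| "pvars (\<^bold>\<box> A) = pvars A"
| "pvars (t \<^bold>: A) = pvars_pol t \<union> pvars A"
| "pvars (\<^bold>K A) = pvars A"
| "pvars (Prove j A) = pvars A"
| "pvars (Proven A) = pvars A"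

definition Form_over :: "pvar set \<Rightarrow> 'ag form set"
  where "Form_over Z = {A. pvars A \<subseteq> Z}"


section \<open>Axiomatic system\<close>

text \<open>
  As the propositional axioms we take all propositional tautologies, where every formula whose
  main connective is not Boolean counts as a propositional atom and is assigned a truth value by
  an arbitrary \<open>v\<close>.
\<close>

fun bool_val :: "('ag form \<Rightarrow> bool) \<Rightarrow> 'ag form \<Rightarrow> bool" where
  "bool_val v (A \<^bold>\<and> B) \<longleftrightarrow> bool_val v A \<and> bool_val v B"
| "bool_val v (\<^bold>\<not> A) \<longleftrightarrow> \<not> bool_val v A"
| "bool_val v A \<longleftrightarrow> v A"

definition tautology :: "'ag form \<Rightarrow> bool"
  where "tautology A \<longleftrightarrow> (\<forall>v. bool_val v A)"

inductive axiom_inst :: "'ag::finite form \<Rightarrow> bool" where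
  A0: "tautology A \<Longrightarrow> axiom_inst A"
| A1_Box_K: "axiom_inst (\<^bold>\<box> (A \<^bold>\<rightarrow> B) \<^bold>\<rightarrow> \<^bold>\<box> A \<^bold>\<rightarrow> \<^bold>\<box> B)"
| A1_Box_T: "axiom_inst (\<^bold>\<box> A \<^bold>\<rightarrow> A)"
| A1_Box_4: "axiom_inst (\<^bold>\<box> A \<^bold>\<rightarrow> \<^bold>\<box> \<^bold>\<box> A)"
| A1_Box_5: "axiom_inst (\<^bold>\<diamond> A \<^bold>\<rightarrow> \<^bold>\<box> \<^bold>\<diamond> A)"
| A1_Stit_K: "axiom_inst (\<^bold>[j\<^bold>] (A \<^bold>\<rightarrow> B) \<^bold>\<rightarrow> \<^bold>[j\<^bold>] A \<^bold>\<rightarrow> \<^bold>[j\<^bold>] B)"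
| A1_Stit_T: "axiom_inst (\<^bold>[j\<^bold>] A \<^bold>\<rightarrow> A)"
| A1_Stit_4: "axiom_inst (\<^bold>[j\<^bold>] A \<^bold>\<rightarrow> \<^bold>[j\<^bold>] \<^bold>[j\<^bold>] A)"
| A1_Stit_5: "axiom_inst (\<^bold>\<langle>j\<^bold>\<rangle> A \<^bold>\<rightarrow> \<^bold>[j\<^bold>] \<^bold>\<langle>j\<^bold>\<rangle> A)"
| A2: "axiom_inst (\<^bold>\<box> A \<^bold>\<rightarrow> \<^bold>[j\<^bold>] A)"
| A3: "jAs \<noteq> [] \<Longrightarrow> distinct (map fst jAs) \<Longrightarrow>
    axiom_inst (Conjs (map (\<lambda>(j, A). \<^bold>\<diamond> \<^bold>[j\<^bold>] A) jAs) \<^bold>\<rightarrow> \<^bold>\<diamond> Conjs (map (\<lambda>(j, A). \<^bold>[j\<^bold>] A) jAs))"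
| A4: "axiom_inst (s \<^bold>: (A \<^bold>\<rightarrow> B) \<^bold>\<rightarrow> t \<^bold>: A \<^bold>\<rightarrow> (s \<^bold>\<times> t) \<^bold>: B)"
| A5: "axiom_inst (t \<^bold>: A \<^bold>\<rightarrow> (\<^bold>! t) \<^bold>: (t \<^bold>: A) \<^bold>\<and> \<^bold>K A)"
| A6: "axiom_inst (s \<^bold>: A \<^bold>\<or> t \<^bold>: A \<^bold>\<rightarrow> (s \<^bold>+ t) \<^bold>: A)"
| A7_K: "axiom_inst (\<^bold>K (A \<^bold>\<rightarrow> B) \<^bold>\<rightarrow> \<^bold>K A \<^bold>\<rightarrow> \<^bold>K B)"
| A7_T: "axiom_inst (\<^bold>K A \<^bold>\<rightarrow> A)"
| A7_4: "axiom_inst (\<^bold>K A \<^bold>\<rightarrow> \<^bold>K \<^bold>K A)"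
| A8: "axiom_inst (\<^bold>K A \<^bold>\<rightarrow> \<^bold>\<box> \<^bold>K \<^bold>\<box> A)"
| A9: "axiom_inst (Prove j A \<^bold>\<rightarrow> \<^bold>\<not> Proven A \<^bold>\<and> \<^bold>[j\<^bold>] Prove j A \<^bold>\<and> \<^bold>K A)"
| A10: "axiom_inst (\<^bold>\<box> Prove j A \<^bold>\<rightarrow> \<^bold>\<box> Prove i A)"
| A11: "axiom_inst (Proven A \<^bold>\<rightarrow> \<^bold>K Proven A \<^bold>\<and> \<^bold>K A)"
| A12: "jAs \<noteq> [] \<Longrightarrow>
    axiom_inst (\<^bold>\<not> \<^bold>K Disjs (map (\<lambda>(j, A). \<^bold>\<langle>\<^bold>K\<^bold>\<rangle> \<^bold>\<diamond> Prove j A) jAs))"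
| A13: "axiom_inst (\<^bold>\<not> Prove j A \<^bold>\<rightarrow> \<^bold>\<langle>j\<^bold>\<rangle> NobodyProves A)"

inductive provable :: "'ag::finite form \<Rightarrow> bool"  (\<open>\<turnstile> _\<close> [40] 40) where
  Ax: "axiom_inst A \<Longrightarrow> \<turnstile> A"
| R1: "\<turnstile> A \<Longrightarrow> \<turnstile> A \<^bold>\<rightarrow> B \<Longrightarrow> \<turnstile> B"
| R2: "\<turnstile> A \<Longrightarrow> \<turnstile> \<^bold>K A"
| R3: "axiom_inst A \<Longrightarrow> \<turnstile> PConst c \<^bold>: A"
| R4: "Bs \<noteq> [] \<Longrightarrow> \<turnstile> \<^bold>K A \<^bold>\<rightarrow> Disjs (map (\<lambda>B. \<^bold>\<not> Proven B) Bs) \<Longrightarrow>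
    \<turnstile> \<^bold>K A \<^bold>\<rightarrow> Disjs (map NobodyProves Bs)"

definition inconsistent :: "'ag::finite form set \<Rightarrow> bool"
  where "inconsistent \<Gamma> \<longleftrightarrow> (\<exists>As. As \<noteq> [] \<and> set As \<subseteq> \<Gamma> \<and> (\<turnstile> Conjs As \<^bold>\<rightarrow> \<^bold>\<bottom>))"

definition consistent :: "'ag::finite form set \<Rightarrow> bool"
  where "consistent \<Gamma> \<longleftrightarrow> \<not> inconsistent \<Gamma>"


section \<open>Models\<close>

text \<open>
  \<open>Tree\<close> is a nonempty set of elements of the type \<open>'m\<close>. The components \<open>Choice\<close>, \<open>Act\<close> and
  \<open>Evid\<close> are total functions, of which only the values at moments in \<open>Tree\<close>, respectively at
  moment-history pairs, matter.
\<close>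

record ('m, 'ag) jstit_structure =
  Tree :: "'m set"
  Le :: "('m \<times> 'm) set"
  Choice :: "'m \<Rightarrow> 'ag \<Rightarrow> 'm set set set"
  Act :: "'m \<Rightarrow> 'm set \<Rightarrow> pol set"
  Rel :: "('m \<times> 'm) set"
  Evid :: "'m \<Rightarrow> pol \<Rightarrow> 'ag form set"
  Val :: "propvar \<Rightarrow> ('m \<times> 'm set) set"

definition Lt :: "('m, 'ag) jstit_structure \<Rightarrow> ('m \<times> 'm) set"
  where "Lt M = Le M - Id"

definition Hist :: "('m, 'ag) jstit_structure \<Rightarrow> 'm set set"
  where "Hist M = {h. pred_on.maxchain (Tree M) (\<lambda>m m'. (m, m') \<in> Le M) h}"

definition HistAt :: "('m, 'ag) jstit_structure \<Rightarrow> 'm \<Rightarrow> 'm set set"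
  where "HistAt M m = {h \<in> Hist M. m \<in> h}"

definition MH :: "('m, 'ag) jstit_structure \<Rightarrow> ('m \<times> 'm set) set"
  where "MH M = {(m, h). m \<in> Tree M \<and> h \<in> HistAt M m}"

definition cell :: "('m, 'ag) jstit_structure \<Rightarrow> 'm \<Rightarrow> 'ag \<Rightarrow> 'm set \<Rightarrow> 'm set set"
  where "cell M m j h = (THE c. c \<in> Choice M m j \<and> h \<in> c)"

definition jstit_model :: "('m, 'ag::finite) jstit_structure \<Rightarrow> bool" where
  "jstit_model M \<longleftrightarrow>
     Tree M \<noteq> {} \<and>
     partial_order_on (Tree M) (Le M) \<and>
     (\<forall>m\<in>Tree M. \<forall>j. partition_on (HistAt M m) (Choice M m j)) \<and>
     preorder_on (Tree M) (Rel M) \<and>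
     (\<forall>p. Val M p \<subseteq> MH M) \<and>
     (\<forall>m\<in>Tree M. \<forall>m'\<in>Tree M. \<exists>m0\<in>Tree M. (m0, m) \<in> Le M \<and> (m0, m') \<in> Le M) \<and>
     (\<forall>m\<in>Tree M. \<forall>m1\<in>Tree M. \<forall>m2\<in>Tree M.
        (m1, m) \<in> Le M \<longrightarrow> (m2, m) \<in> Le M \<longrightarrow> (m1, m2) \<in> Le M \<or> (m2, m1) \<in> Le M) \<and>
     (\<forall>m\<in>Tree M. \<forall>m'\<in>Tree M. \<forall>h\<in>HistAt M m. \<forall>h'\<in>HistAt M m. \<forall>j.
        (m, m') \<in> Lt M \<longrightarrow> m' \<in> h \<inter> h' \<longrightarrow> cell M m j h = cell M m j h') \<and>
     (\<forall>m\<in>Tree M. \<forall>f. (\<forall>j. f j \<in> Choice M m j) \<longrightarrow> (\<Inter>j. f j) \<noteq> {}) \<and>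
     (\<forall>m m' t. (m, m') \<in> Rel M \<longrightarrow> Evid M m t \<subseteq> Evid M m' t) \<and>
     (\<forall>m\<in>Tree M. \<forall>s t A B.
        (A \<^bold>\<rightarrow> B \<in> Evid M m s \<longrightarrow> A \<in> Evid M m t \<longrightarrow> B \<in> Evid M m (s \<^bold>\<times> t)) \<and>
        Evid M m s \<union> Evid M m t \<subseteq> Evid M m (s \<^bold>+ t) \<and>
        (A \<in> Evid M m t \<longrightarrow> t \<^bold>: A \<in> Evid M m (\<^bold>! t))) \<and>
     (\<forall>m\<in>Tree M. \<forall>m'\<in>Tree M. (m', m) \<in> Lt M \<longrightarrow> (\<forall>h\<in>HistAt M m. Act M m' h \<subseteq> Act M m h)) \<and>
     (\<forall>m\<in>Tree M. (\<Inter>h\<in>HistAt M m. Act M m h) \<subseteq>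
        (\<Union>m'\<in>{m' \<in> Tree M. (m', m) \<in> Lt M}. \<Union>h\<in>HistAt M m. Act M m' h)) \<and>
     (\<forall>m\<in>Tree M. \<forall>h\<in>HistAt M m. \<forall>h'\<in>HistAt M m.
        (\<exists>m'\<in>h \<inter> h'. (m, m') \<in> Lt M) \<longrightarrow> Act M m h = Act M m h') \<and>
     Le M \<subseteq> Rel M \<and>
     (\<forall>m m'. (m, m') \<in> Rel M \<longrightarrow>
        (\<Inter>h\<in>HistAt M m. Act M m h) \<subseteq> (\<Inter>h'\<in>HistAt M m'. Act M m' h'))"

definition normal :: "('m, 'ag::finite) jstit_structure \<Rightarrow> bool"
  where "normal M \<longleftrightarrow> (\<forall>c. \<forall>m\<in>Tree M. \<forall>A. axiom_inst A \<longrightarrow> A \<in> Evid M m (PConst c))"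


section \<open>Satisfaction\<close>

text \<open>
  The semantic clauses for \<open>\<^bold>K A\<close> and \<open>t \<^bold>: A\<close>, for an arbitrary interpretation \<open>P\<close> of \<open>A\<close>. They are
  stated separately because satisfaction of \<open>t \<^bold>: A\<close> and of \<open>Prove j A\<close> refers to satisfaction of
  formulas that are not subformulas; see the lemma \<open>sat_clauses\<close> below.
\<close>

definition knows :: "('m, 'ag) jstit_structure \<Rightarrow> ('m \<Rightarrow> 'm set \<Rightarrow> bool) \<Rightarrow> 'm \<Rightarrow> bool"
  where "knows M P m \<longleftrightarrow> (\<forall>m'. (m, m') \<in> Rel M \<longrightarrow> (\<forall>h'\<in>HistAt M m'. P m' h'))"

definition justified ::
    "('m, 'ag) jstit_structure \<Rightarrow> pol \<Rightarrow> 'ag form \<Rightarrow> ('m \<Rightarrow> 'm set \<Rightarrow> bool) \<Rightarrow> 'm \<Rightarrow> bool"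
  where "justified M t A P m \<longleftrightarrow> A \<in> Evid M m t \<and> knows M P m"

primrec sat :: "('m, 'ag) jstit_structure \<Rightarrow> 'ag form \<Rightarrow> 'm \<Rightarrow> 'm set \<Rightarrow> bool" where
  "sat M (Atom p) = (\<lambda>m h. (m, h) \<in> Val M p)"
| "sat M (A \<^bold>\<and> B) = (\<lambda>m h. sat M A m h \<and> sat M B m h)"
| "sat M (\<^bold>\<not> A) = (\<lambda>m h. \<not> sat M A m h)"
| "sat M (\<^bold>[j\<^bold>] A) = (\<lambda>m h. \<forall>h'\<in>cell M m j h. sat M A m h')"
| "sat M (\<^bold>\<box> A) = (\<lambda>m h. \<forall>h'\<in>HistAt M m. sat M A m h')"
| "sat M (t \<^bold>: A) = (\<lambda>m h. justified M t A (sat M A) m)"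
| "sat M (\<^bold>K A) = (\<lambda>m h. knows M (sat M A) m)"
| "sat M (Prove j A) = (\<lambda>m h.
     (\<forall>h'\<in>cell M m j h. \<exists>t\<in>Act M m h'. justified M t A (sat M A) m) \<and>
     (\<forall>s. \<exists>h''\<in>HistAt M m. justified M s A (sat M A) m \<longrightarrow> s \<notin> Act M m h''))"
| "sat M (Proven A) = (\<lambda>m h.
     \<exists>t. \<forall>h'\<in>HistAt M m. t \<in> Act M m h' \<and> justified M t A (sat M A) m)"

lemma sat_clauses:
  "sat M (\<^bold>K A) m h \<longleftrightarrow> (\<forall>m'. (m, m') \<in> Rel M \<longrightarrow> (\<forall>h'\<in>HistAt M m'. sat M A m' h'))"
  "sat M (t \<^bold>: A) m h \<longleftrightarrow> A \<in> Evid M m t \<and> sat M (\<^bold>K A) m h"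
  "sat M (Prove j A) m h \<longleftrightarrow>
     (\<forall>h'\<in>cell M m j h. \<exists>t\<in>Act M m h'. sat M (t \<^bold>: A) m h') \<and>
     (\<forall>s. \<exists>h''\<in>HistAt M m. sat M (s \<^bold>: A) m h \<longrightarrow> s \<notin> Act M m h'')"
  "sat M (Proven A) m h \<longleftrightarrow>
     (\<exists>t. \<forall>h'\<in>HistAt M m. t \<in> Act M m h' \<and> sat M (t \<^bold>: A) m h)"
  by (simp_all add: knows_def justified_def)

text \<open>
  Satisfiability in a normal jstit model whose moments are elements of the type \<open>'m\<close>, which is
  passed as the first argument since HOL cannot quantify over the types of moments.
\<close>

definition satisfiable :: "'m itself \<Rightarrow> 'ag::finite form set \<Rightarrow> bool" where
  "satisfiable (_ :: 'm itself) \<Gamma> \<longleftrightarrow>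
     (\<exists>(M :: ('m, 'ag) jstit_structure) m h.
        jstit_model M \<and> normal M \<and> (m, h) \<in> MH M \<and> (\<forall>A\<in>\<Gamma>. sat M A m h))"

text \<open>
  Completeness has to name a type from which the moments of the satisfying model are taken. This
  one has the cardinality of the power set of the continuum, so the finite sequences of maximal
  consistent sets, and equivalence classes of them, fit into it.
\<close>

type_synonym 'ag moment = "'ag form set list set"

end

theory Submission
  imports Defs "HOL-Library.Sublist"
begin

text \<open>
  Soundness of A12 and R4: if \<open>Prove j A\<close> holds at \<open>(m, h)\<close>, then \<open>m\<close> is not the last moment of
  \<open>h\<close>, since otherwise \<open>h\<close> is the only history through \<open>m\<close> and the presented proof is presented at
  all of them; and at every later moment of \<open>h\<close> the formula is proven.

  Completeness: moments are finite sequences of choices of maximal consistent sets. A moment \<open>w\<close> carries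
  a \<open>\<box>\<close>-class of such sets, with representative \<open>rep w\<close>, and a history through \<open>w\<close> picks a member \<open>S\<close>
  of that class; the next moment carries the class of \<open>succ S\<close>, which by R4 can be chosen to contain
  \<open>A\<close> for each \<open>KA \<in> S\<close> and \<open>Proven A\<close> for each \<open>Prove j A \<in> S\<close>. The presented proofs are fresh variables,
  which do not interfere with the evidence for terms over \<open>X\<close>. The set \<open>succ S\<close> may contain \<open>Proven A\<close>
  for formulas that nobody proved in \<open>S\<close>, whereas a shared proof must have been presented earlier.
  Hence at \<open>S\<close> one also presents a second kind of variable for \<open>A\<close>, which becomes evidence for \<open>A\<close> only
  where \<open>Proven A\<close> holds.
\<close>

section \<open>Derivations and maximal consistent sets\<close>

lemma bool_val_Bot [simp]: "\<not> bool_val v \<^bold>\<bottom>"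
  by (simp add: Bot_def)

lemma bool_val_Conjs [simp]: "bool_val v (Conjs As) \<longleftrightarrow> (\<forall>A\<in>set As. bool_val v A)"
  by (induction As rule: Conjs.induct) auto

lemma bool_val_Disjs [simp]: "bool_val v (Disjs As) \<longleftrightarrow> (\<exists>A\<in>set As. bool_val v A)"
  by (induction As rule: Disjs.induct) auto

lemma provable_taut: "(\<And>v. bool_val v A) \<Longrightarrow> \<turnstile> A"
  by (simp add: A0 Ax tautology_def)

lemma provable_taut1: "\<turnstile> A \<Longrightarrow> (\<And>v. bool_val v A \<Longrightarrow> bool_val v B) \<Longrightarrow> \<turnstile> B"
  by (rule R1[of A]) (auto intro: provable_taut)

lemma provable_taut2:
  assumes "\<turnstile> A" "\<turnstile> B" "\<And>v. bool_val v A \<Longrightarrow> bool_val v B \<Longrightarrow> bool_val v C"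
  shows "\<turnstile> C"
proof -
  have "\<turnstile> B \<^bold>\<rightarrow> C"
    using assms(1) by (rule provable_taut1) (use assms(3) in auto)
  then show ?thesis using assms(2) R1 by blast
qed

text \<open>Maximality is left to \<open>mcs\<close>, because the label of the root of the canonical
  tree is the set of all theorems, which is only closed.\<close>

definition closed_theory :: "'ag::finite form set \<Rightarrow> bool" where
  "closed_theory S \<longleftrightarrow> (\<forall>A. (\<turnstile> A) \<longrightarrow> A \<in> S) \<and> (\<forall>A B. A \<in> S \<longrightarrow> A \<^bold>\<rightarrow> B \<in> S \<longrightarrow> B \<in> S)"

definition mcs :: "'ag::finite form set \<Rightarrow> bool" where
  "mcs S \<longleftrightarrow> closed_theory S \<and> (\<forall>A. \<^bold>\<not> A \<in> S \<longleftrightarrow> A \<notin> S)"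

definition entails :: "'ag::finite form set \<Rightarrow> 'ag form \<Rightarrow> bool" where
  "entails \<Gamma> A \<longleftrightarrow> (\<exists>As. set As \<subseteq> \<Gamma> \<and> (\<turnstile> Conjs As \<^bold>\<rightarrow> A))"

lemma closed_theory_provable: "closed_theory S \<Longrightarrow> \<turnstile> A \<Longrightarrow> A \<in> S"
  by (simp add: closed_theory_def)

lemma closed_theory_mp: "closed_theory S \<Longrightarrow> A \<^bold>\<rightarrow> B \<in> S \<Longrightarrow> A \<in> S \<Longrightarrow> B \<in> S"
  unfolding closed_theory_def by (drule conjunct2, drule spec[of _ A], drule spec[of _ B]) simp

lemma closed_theory_imp: "closed_theory S \<Longrightarrow> \<turnstile> A \<^bold>\<rightarrow> B \<Longrightarrow> A \<in> S \<Longrightarrow> B \<in> S"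
  by (rule closed_theory_mp[OF _ closed_theory_provable])

lemma closed_theory_taut1:
  "closed_theory S \<Longrightarrow> A \<in> S \<Longrightarrow> (\<And>v. bool_val v A \<Longrightarrow> bool_val v B) \<Longrightarrow> B \<in> S"
  by (rule closed_theory_imp[of S A]) (auto intro: provable_taut)

lemma closed_theory_taut2:
  assumes "closed_theory S" "A \<in> S" "B \<in> S"
    and "\<And>v. bool_val v A \<Longrightarrow> bool_val v B \<Longrightarrow> bool_val v C"
  shows "C \<in> S"
proof -
  have "B \<^bold>\<rightarrow> C \<in> S"
    using assms(1,2) by (rule closed_theory_taut1) (use assms(4) in auto)
  then show ?thesis by (rule closed_theory_mp[OF assms(1) _ assms(3)])
qed

lemma closed_theory_theorems: "closed_theory {A. \<turnstile> A}"
  unfolding closed_theory_def using R1 by blast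

lemma closed_theory_Conjs:
  assumes "closed_theory S"
  shows "Conjs As \<in> S \<longleftrightarrow> set As \<subseteq> S"
proof
  assume "Conjs As \<in> S"
  then show "set As \<subseteq> S"
    using assms by (auto intro: closed_theory_taut1)
next
  show "set As \<subseteq> S \<Longrightarrow> Conjs As \<in> S"
  proof (induction As)
    case Nil
    show ?case by (rule closed_theory_provable[OF assms]) (auto intro: provable_taut)
  next
    case (Cons A As)
    then have "A \<in> S" "Conjs As \<in> S" by auto
    then show ?case by (rule closed_theory_taut2[OF assms]) auto
  qed
qed

lemma closed_theory_entails: "closed_theory S \<Longrightarrow> entails S A \<Longrightarrow> A \<in> S"
  unfolding entails_def using closed_theory_Conjs closed_theory_imp by blast

lemma mcs_closed: "mcs S \<Longrightarrow> closed_theory S"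
  by (simp add: mcs_def)

lemma mcs_Neg: "mcs S \<Longrightarrow> \<^bold>\<not> A \<in> S \<longleftrightarrow> A \<notin> S"
  by (simp add: mcs_def)

lemma mcs_Bot: "mcs S \<Longrightarrow> \<^bold>\<bottom> \<notin> S"
  using closed_theory_provable[OF mcs_closed provable_taut, of S "\<^bold>\<top>"] mcs_Neg[of S "\<^bold>\<bottom>"]
  by simp

lemma mcs_Conj: "mcs S \<Longrightarrow> A \<^bold>\<and> B \<in> S \<longleftrightarrow> A \<in> S \<and> B \<in> S"
  using closed_theory_Conjs[of S "[A, B]"] by (simp add: mcs_closed)

lemma mcs_imp: "mcs S \<Longrightarrow> \<turnstile> A \<^bold>\<rightarrow> B \<Longrightarrow> A \<in> S \<Longrightarrow> B \<in> S"
  using closed_theory_imp mcs_closed by blast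

lemma mcs_Disjs:
  assumes "mcs S" "Disjs As \<in> S"
  shows "\<exists>A\<in>set As. A \<in> S"
  using assms
proof (induction As rule: Disjs.induct)
  case 1
  then show ?case by (simp add: mcs_Bot)
qed (auto simp: mcs_Neg mcs_Conj)

text \<open>Deduction theorem. Premises enter only through a provable implication, so R2 never acts
  on them, and all occurrences of \<open>A\<close> can be moved to the right.\<close>

lemma entails_insert:
  assumes "entails (insert A \<Gamma>) B"
  shows "entails \<Gamma> (A \<^bold>\<rightarrow> B)"
proof -
  obtain As where As: "set As \<subseteq> insert A \<Gamma>" "\<turnstile> Conjs As \<^bold>\<rightarrow> B"
    using assms unfolding entails_def by blast
  have "\<turnstile> Conjs (filter (\<lambda>C. C \<noteq> A) As) \<^bold>\<rightarrow> A \<^bold>\<rightarrow> B"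
    using As(2) by (rule provable_taut1) auto
  moreover have "set (filter (\<lambda>C. C \<noteq> A) As) \<subseteq> \<Gamma>"
    using As(1) by auto
  ultimately show ?thesis
    unfolding entails_def by blast
qed

lemma entails_taut2:
  assumes "entails \<Gamma> A" "entails \<Gamma> B"
    and "\<And>v. bool_val v A \<Longrightarrow> bool_val v B \<Longrightarrow> bool_val v C"
  shows "entails \<Gamma> C"
proof -
  obtain As Bs where *: "set As \<subseteq> \<Gamma>" "\<turnstile> Conjs As \<^bold>\<rightarrow> A" "set Bs \<subseteq> \<Gamma>" "\<turnstile> Conjs Bs \<^bold>\<rightarrow> B"
    using assms(1,2) unfolding entails_def by blast
  have "\<turnstile> Conjs (As @ Bs) \<^bold>\<rightarrow> C"
    using *(2,4) by (rule provable_taut2) (use assms(3) in auto)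
  moreover have "set (As @ Bs) \<subseteq> \<Gamma>" using * by simp
  ultimately show ?thesis unfolding entails_def by blast
qed

lemma entails_member: "A \<in> \<Gamma> \<Longrightarrow> entails \<Gamma> A"
  unfolding entails_def by (intro exI[of _ "[A]"]) (auto intro: provable_taut)

lemma entails_provable:
  assumes "\<turnstile> A" shows "entails \<Gamma> A"
proof -
  have "\<turnstile> Conjs [] \<^bold>\<rightarrow> A"
    using assms by (rule provable_taut1) simp
  then show ?thesis
    unfolding entails_def by (metis empty_set empty_subsetI)
qed

text \<open>Zorn's lemma on the consistent extensions of \<open>\<Gamma>\<close>. The union of a
  chain stays consistent, since a derivation of falsity uses finitely many premises and these lie in
  one member of the chain.\<close>

lemma Lindenbaum:
  assumes "\<not> entails \<Gamma> \<^bold>\<bottom>"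
  shows "\<exists>S. mcs S \<and> \<Gamma> \<subseteq> S"
proof -
  let ?F = "{S. \<Gamma> \<subseteq> S \<and> \<not> entails S \<^bold>\<bottom>}"
  have "\<exists>M\<in>?F. \<forall>S\<in>?F. M \<subseteq> S \<longrightarrow> S = M"
  proof (rule subset_Zorn_nonempty)
    show "?F \<noteq> {}" using assms by blast
  next
    fix C assume C: "C \<noteq> {}" "subset.chain ?F C"
    then have "\<Gamma> \<subseteq> \<Union>C"
      unfolding subset.chain_def by blast
    moreover have "\<not> entails (\<Union>C) \<^bold>\<bottom>"
    proof
      assume "entails (\<Union>C) \<^bold>\<bottom>"
      then obtain As where As: "set As \<subseteq> \<Union>C" "\<turnstile> Conjs As \<^bold>\<rightarrow> \<^bold>\<bottom>"
        unfolding entails_def by blast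
      obtain S where "S \<in> C" "set As \<subseteq> S"
        using finite_subset_Union_chain[OF _ As(1) C] by auto
      then have "entails S \<^bold>\<bottom>" "S \<in> ?F"
        using As(2) C(2) unfolding entails_def subset.chain_def by auto
      then show False by blast
    qed
    ultimately show "\<Union>C \<in> ?F" by blast
  qed
  then obtain M where "M \<in> ?F" and max: "\<forall>S\<in>?F. M \<subseteq> S \<longrightarrow> S = M"
    by (rule bexE)
  then have M: "\<Gamma> \<subseteq> M" "\<not> entails M \<^bold>\<bottom>"
    by simp_all
  have insert: "entails M (A \<^bold>\<rightarrow> \<^bold>\<bottom>)" if "A \<notin> M" for A
  proof (rule entails_insert, rule ccontr)
    assume "\<not> entails (insert A M) \<^bold>\<bottom>"
    moreover have "\<Gamma> \<subseteq> insert A M"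
      using M(1) by blast
    ultimately have "insert A M = M"
      using max[rule_format, of "insert A M"] by blast
    then show False using that by blast
  qed
  have closed: "A \<in> M" if "entails M A" for A
  proof (rule ccontr)
    assume "A \<notin> M"
    from that insert[OF this] have "entails M \<^bold>\<bottom>"
      by (rule entails_taut2) simp
    then show False using M(2) by blast
  qed
  have "closed_theory M"
    unfolding closed_theory_def
  proof (intro conjI allI impI)
    fix A B assume "A \<in> M" "A \<^bold>\<rightarrow> B \<in> M"
    from this[THEN entails_member] have "entails M B"
      by (rule entails_taut2) simp
    then show "B \<in> M" by (rule closed)
  qed (simp add: closed entails_provable)
  moreover have "\<^bold>\<not> A \<in> M \<longleftrightarrow> A \<notin> M" for A
  proof
    assume "\<^bold>\<not> A \<in> M"
    show "A \<notin> M"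
    proof
      assume "A \<in> M"
      from entails_member[OF this] entails_member[OF \<open>\<^bold>\<not> A \<in> M\<close>] have "entails M \<^bold>\<bottom>"
        by (rule entails_taut2) simp
      then show False using M(2) by blast
    qed
  next
    assume "A \<notin> M"
    from insert[OF this] insert[OF this] have "entails M (\<^bold>\<not> A)"
      by (rule entails_taut2) simp
    then show "\<^bold>\<not> A \<in> M" by (rule closed)
  qed
  ultimately show ?thesis
    using M(1) unfolding mcs_def by blast
qed

section \<open>Normal operators\<close>

text \<open>Operators are functions on formulas, so that \<open>Know\<close>, \<open>Box\<close> and
  each \<open>Stit j\<close> share one set of canonical model arguments.\<close>

definition normal_op :: "('ag::finite form \<Rightarrow> 'ag form) \<Rightarrow> bool" where
  "normal_op f \<longleftrightarrow> (\<forall>A. (\<turnstile> A) \<longrightarrow> (\<turnstile> f A)) \<and> (\<forall>A B. \<turnstile> f (A \<^bold>\<rightarrow> B) \<^bold>\<rightarrow> f A \<^bold>\<rightarrow> f B)"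

definition s5_op :: "('ag::finite form \<Rightarrow> 'ag form) \<Rightarrow> bool" where
  "s5_op f \<longleftrightarrow> normal_op f \<and>
    (\<forall>A. (\<turnstile> f A \<^bold>\<rightarrow> A) \<and> (\<turnstile> f A \<^bold>\<rightarrow> f (f A)) \<and> (\<turnstile> \<^bold>\<not> f (\<^bold>\<not> A) \<^bold>\<rightarrow> f (\<^bold>\<not> f (\<^bold>\<not> A))))"

text \<open>For S5 operators, equality of these sets is the canonical equivalence of maximal
  consistent sets; for \<open>Know\<close>, inclusion of \<open>boxed Know S\<close> in
  \<open>S'\<close> is the canonical accessibility.\<close>

definition boxed :: "('ag form \<Rightarrow> 'ag form) \<Rightarrow> 'ag form set \<Rightarrow> 'ag form set" where
  "boxed f S = {A. f A \<in> S}"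

lemma normal_op_nec: "normal_op f \<Longrightarrow> \<turnstile> A \<Longrightarrow> \<turnstile> f A"
  and normal_op_K: "normal_op f \<Longrightarrow> \<turnstile> f (A \<^bold>\<rightarrow> B) \<^bold>\<rightarrow> f A \<^bold>\<rightarrow> f B"
  by (simp_all add: normal_op_def)

lemma s5_normal: "s5_op f \<Longrightarrow> normal_op f"
  and s5_T: "s5_op f \<Longrightarrow> \<turnstile> f A \<^bold>\<rightarrow> A"
  and s5_4: "s5_op f \<Longrightarrow> \<turnstile> f A \<^bold>\<rightarrow> f (f A)"
  and s5_5: "s5_op f \<Longrightarrow> \<turnstile> \<^bold>\<not> f (\<^bold>\<not> A) \<^bold>\<rightarrow> f (\<^bold>\<not> f (\<^bold>\<not> A))"
  by (simp_all add: s5_op_def)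

text \<open>Necessitation for the box is derived: R2 and A8 put box, \<open>K\<close> and box in
  front of \<open>A\<close>, and the T axioms strip the outer two.\<close>

lemma provable_Box_nec:
  assumes "\<turnstile> A" shows "\<turnstile> \<^bold>\<box> A"
proof -
  have "\<turnstile> \<^bold>\<box> \<^bold>K \<^bold>\<box> A"
    using R2[OF assms] Ax[OF A8] by (rule R1)
  then have "\<turnstile> \<^bold>K \<^bold>\<box> A"
    using Ax[OF A1_Box_T] by (rule R1)
  then show ?thesis
    using Ax[OF A7_T] by (rule R1)
qed

lemma normal_Know: "normal_op Know"
  by (simp add: normal_op_def R2 Ax[OF A7_K])

lemma s5_Box: "s5_op Box"
  by (simp add: s5_op_def normal_op_def provable_Box_nec Ax axiom_inst.intros)

lemma s5_Stit: "s5_op (Stit j)"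
proof -
  have "\<turnstile> \<^bold>[j\<^bold>] A" if "\<turnstile> A" for A
    using provable_Box_nec[OF that] Ax[OF A2] by (rule R1)
  then show ?thesis
    by (simp add: s5_op_def normal_op_def Ax axiom_inst.intros)
qed

text \<open>Induction on the premises with the conclusion general: the head \<open>B\<close> is
  moved to the right of the implication, and the K axiom for \<open>f\<close> then detaches
  \<open>f B\<close>.\<close>

lemma normal_op_entails:
  assumes "closed_theory S" "normal_op f" "entails (boxed f S) A"
  shows "f A \<in> S"
proof -
  have "f A \<in> S" if "set Bs \<subseteq> boxed f S" "\<turnstile> Conjs Bs \<^bold>\<rightarrow> A" for Bs A
    using that
  proof (induction Bs arbitrary: A)
    case Nil
    from Nil(2) have "\<turnstile> A" by (rule provable_taut1) simp
    then show ?case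
      by (rule closed_theory_provable[OF assms(1) normal_op_nec[OF assms(2)]])
  next
    case (Cons B Bs)
    have "\<turnstile> Conjs Bs \<^bold>\<rightarrow> B \<^bold>\<rightarrow> A"
      using Cons.prems(2) by (rule provable_taut1) auto
    then have "f (B \<^bold>\<rightarrow> A) \<in> S"
      using Cons by auto
    moreover have "f B \<in> S"
      using Cons.prems(1) by (simp add: boxed_def)
    ultimately show ?case
      using closed_theory_mp[OF assms(1) closed_theory_imp[OF assms(1) normal_op_K[OF assms(2)]]]
      by blast
  qed
  with assms(3) show ?thesis
    unfolding entails_def by (elim exE conjE)
qed

lemma normal_op_mono:
  assumes "closed_theory S" "normal_op f" "\<turnstile> A \<^bold>\<rightarrow> B" "f A \<in> S"
  shows "f B \<in> S"
proof -
  have "entails (boxed f S) B"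
    unfolding entails_def using assms(3,4) by (intro exI[of _ "[A]"]) (simp add: boxed_def)
  then show ?thesis by (rule normal_op_entails[OF assms(1,2)])
qed

text \<open>If adding the negation of \<open>A\<close> to \<open>boxed f S\<close> were
  inconsistent, \<open>boxed f S\<close> would entail \<open>A\<close>, and \<open>f A\<close> would
  lie in \<open>S\<close>. Otherwise Lindenbaum's lemma applies.\<close>

lemma normal_op_witness:
  assumes "mcs S" "normal_op f" "f A \<notin> S"
  shows "\<exists>S'. mcs S' \<and> boxed f S \<subseteq> S' \<and> A \<notin> S'"
proof -
  have "\<not> entails (insert (\<^bold>\<not> A) (boxed f S)) \<^bold>\<bottom>"
  proof
    assume "entails (insert (\<^bold>\<not> A) (boxed f S)) \<^bold>\<bottom>"
    then have E: "entails (boxed f S) (\<^bold>\<not> A \<^bold>\<rightarrow> \<^bold>\<bottom>)" by (rule entails_insert)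
    have "entails (boxed f S) A" by (rule entails_taut2[OF E E]) simp
    then show False
      using normal_op_entails[OF mcs_closed[OF assms(1)] assms(2)] assms(3) by blast
  qed
  from Lindenbaum[OF this] show ?thesis
    using mcs_Neg by blast
qed

text \<open>Axiom 4 for \<open>f\<close> gives one inclusion, axiom 5 the other. So canonical
  accessibility for \<open>f\<close> is already an equivalence.\<close>

lemma s5_boxed_eq:
  assumes "mcs S" "mcs S'" "s5_op f" "boxed f S \<subseteq> S'"
  shows "boxed f S = boxed f S'"
proof (intro equalityI subsetI)
  fix A assume "A \<in> boxed f S"
  then have "f (f A) \<in> S"
    using mcs_imp[OF assms(1) s5_4[OF assms(3)]] unfolding boxed_def by blast
  then show "A \<in> boxed f S'"
    using assms(4) unfolding boxed_def by blast
next
  note cl = assms(1,2)[THEN mcs_closed]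
  fix A assume "A \<in> boxed f S'"
  \<comment> \<open>Axiom 5 speaks of \<open>f\<close> applied to a negation, so \<open>A\<close> is
    first replaced by its double negation.\<close>
  then have "f (\<^bold>\<not> \<^bold>\<not> A) \<in> S'"
    using normal_op_mono[OF cl(2) s5_normal[OF assms(3)], of A "\<^bold>\<not> \<^bold>\<not> A"]
    by (simp add: boxed_def provable_taut)
  then have "\<^bold>\<not> f (\<^bold>\<not> \<^bold>\<not> A) \<notin> boxed f S"
    using assms(2,4) by (auto simp: mcs_Neg)
  then have "\<^bold>\<not> f (\<^bold>\<not> \<^bold>\<not> A) \<notin> S"
    using mcs_imp[OF assms(1) s5_5[OF assms(3)]] unfolding boxed_def by blast
  then have "f (\<^bold>\<not> \<^bold>\<not> A) \<in> S"
    using assms(1) by (simp add: mcs_Neg)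
  then show "A \<in> boxed f S"
    using normal_op_mono[OF cl(1) s5_normal[OF assms(3)], of "\<^bold>\<not> \<^bold>\<not> A" A]
    by (simp add: boxed_def provable_taut)
qed

lemma s5_boxed_refl: "mcs S \<Longrightarrow> s5_op f \<Longrightarrow> boxed f S \<subseteq> S"
  unfolding boxed_def using mcs_imp[OF _ s5_T] by blast

section \<open>Knowledge and the classes of box and stit operators\<close>

lemma Know_boxed_trans:
  assumes "closed_theory S" "boxed Know S \<subseteq> S'" "boxed Know S' \<subseteq> S''"
  shows "boxed Know S \<subseteq> S''"
  using assms closed_theory_imp[OF assms(1) Ax[OF A7_4]] unfolding boxed_def by blast

lemma Know_boxed_refl: "closed_theory S \<Longrightarrow> boxed Know S \<subseteq> S"
  using closed_theory_imp[OF _ Ax[OF A7_T]] unfolding boxed_def by blast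

lemma Know_Know_Box:
  assumes "closed_theory S" "\<^bold>K A \<in> S" shows "\<^bold>K \<^bold>\<box> A \<in> S"
  using closed_theory_imp[OF assms(1) Ax[OF A1_Box_T] closed_theory_imp[OF assms(1) Ax[OF A8] assms(2)]] .

lemma Know_Box_Know:
  assumes "closed_theory S" "\<^bold>K A \<in> S" shows "\<^bold>\<box> \<^bold>K A \<in> S"
proof -
  have "\<turnstile> \<^bold>K \<^bold>\<box> A \<^bold>\<rightarrow> \<^bold>K A"
    by (rule R1[OF R2[OF Ax[OF A1_Box_T]] Ax[OF A7_K]])
  moreover have "\<^bold>\<box> \<^bold>K \<^bold>\<box> A \<in> S"
    using assms closed_theory_imp[OF assms(1) Ax[OF A8]] by blast
  ultimately show ?thesis
    using normal_op_mono[OF assms(1) s5_normal[OF s5_Box]] by blast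
qed

text \<open>By A8, a known formula is known throughout the box class. Hence what is known at a
  moment can be read off any representative.\<close>

lemma Box_class_Know:
  assumes "mcs S" "mcs S'" "boxed Box S = boxed Box S'"
  shows "\<^bold>K A \<in> S \<longleftrightarrow> \<^bold>K A \<in> S'"
proof -
  have "\<^bold>K A \<in> S \<longleftrightarrow> \<^bold>K A \<in> boxed Box S" if "mcs S" for S
    using Know_Box_Know[OF mcs_closed[OF that]] s5_boxed_refl[OF that s5_Box]
    by (auto simp: boxed_def)
  then show ?thesis using assms by simp
qed

text \<open>Meant for formulas \<open>K A\<close>, \<open>Just t A\<close> and
  \<open>Proven A\<close>, which imply their own knowledge and so do not depend on the history
  through a moment.\<close>

lemma Box_class_Know_imp:
  assumes "mcs S" "mcs S'" "boxed Box S = boxed Box S'" "\<turnstile> A \<^bold>\<rightarrow> \<^bold>K A"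
  shows "A \<in> S \<longleftrightarrow> A \<in> S'"
proof -
  have "A \<in> S \<longleftrightarrow> \<^bold>K A \<in> S" if "mcs S" for S
    using mcs_imp[OF that assms(4)] mcs_imp[OF that Ax[OF A7_T]] by auto
  then show ?thesis using Box_class_Know[OF assms(1-3)] assms by simp
qed

text \<open>A5 is used twice: it turns \<open>t\<close> into a checked proof of
  \<open>Just t A\<close>, and applied to that proof it yields knowledge of
  \<open>Just t A\<close>.\<close>

lemma provable_Just_Know: "\<turnstile> t \<^bold>: A \<^bold>\<rightarrow> \<^bold>K (t \<^bold>: A)"
  using Ax[OF A5[of t A]] Ax[OF A5[of "\<^bold>! t" "t \<^bold>: A"]] by (rule provable_taut2) auto

lemma provable_Proven_Know: "\<turnstile> Proven A \<^bold>\<rightarrow> \<^bold>K Proven A"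
  using Ax[OF A11[of A]] by (rule provable_taut1) auto

lemma Stit_class_Box:
  assumes "mcs S" "mcs S'" "boxed (Stit j) S \<subseteq> S'"
  shows "boxed Box S = boxed Box S'"
proof (rule s5_boxed_eq[OF assms(1,2) s5_Box], rule subsetI)
  fix A assume "A \<in> boxed Box S"
  then have "\<^bold>[j\<^bold>] A \<in> S"
    using mcs_imp[OF assms(1) Ax[OF A2]] unfolding boxed_def by blast
  then show "A \<in> S'"
    using assms(3) unfolding boxed_def by blast
qed

section \<open>Successor sets and independence of agents for maximal consistent sets\<close>

lemma NobodyProves_mcs:
  "mcs S \<Longrightarrow> NobodyProves A \<in> S \<longleftrightarrow> (\<forall>j. Prove j A \<notin> S)"
  by (simp add: NobodyProves_def closed_theory_Conjs mcs_closed agents image_subset_iff mcs_Neg)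

text \<open>This is where R4 enters. If the required set were inconsistent, some known conjunction
  would refute finitely many \<open>Proven B\<close> together, and by R4 some such \<open>B\<close>
  would be proved by nobody in \<open>S\<close>, contrary to its choice.\<close>

lemma successor_exists:
  fixes S :: "'ag::finite form set"
  assumes "mcs S"
  shows "\<exists>S'. mcs S' \<and> boxed Know S \<subseteq> S' \<and> (\<forall>j A. Prove j A \<in> S \<longrightarrow> Proven A \<in> S')"
proof -
  let ?P = "{Proven A |A. \<exists>j. Prove j A \<in> S}"
  have "\<not> entails (boxed Know S \<union> ?P) \<^bold>\<bottom>"
  proof
    assume "entails (boxed Know S \<union> ?P) \<^bold>\<bottom>"
    then obtain Cs where Cs: "set Cs \<subseteq> boxed Know S \<union> ?P" "\<turnstile> Conjs Cs \<^bold>\<rightarrow> \<^bold>\<bottom>"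
      unfolding entails_def by blast
    define As where "As = filter (\<lambda>C. C \<in> boxed Know S) Cs"
    have "set (filter (\<lambda>C. C \<notin> boxed Know S) Cs) \<subseteq> Proven ` {A. \<exists>j. Prove j A \<in> S}"
      using Cs(1) by fastforce
    then obtain T where T: "finite T" "T \<subseteq> {A. \<exists>j. Prove j A \<in> S}"
      "set (filter (\<lambda>C. C \<notin> boxed Know S) Cs) = Proven ` T"
      by (meson List.finite_set finite_subset_image)
    then obtain Bs where Bs: "set Bs = T" using finite_list by blast
    have split: "set Cs = set As \<union> Proven ` set Bs"
      using T(3) unfolding As_def Bs by auto
    have "entails (boxed Know S) (Conjs As)"
      unfolding entails_def As_def by (intro exI[of _ As] conjI provable_taut) (auto simp: As_def)
    then have KAs: "\<^bold>K Conjs As \<in> S"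
      using normal_op_entails[OF mcs_closed[OF assms] normal_Know] by blast
    have prov: "\<turnstile> \<^bold>K Conjs As \<^bold>\<rightarrow> Disjs (map (\<lambda>B. \<^bold>\<not> Proven B) Bs)"
      using Cs(2) Ax[OF A7_T[of "Conjs As"]]
      by (rule provable_taut2) (auto simp: split ball_Un)
    show False
    proof (cases "Bs = []")
      \<comment> \<open>R4 needs at least one formula; without any, \<open>prov\<close> already puts
        falsity, the empty disjunction, into \<open>S\<close>.\<close>
      case True
      then show False
        using mcs_imp[OF assms prov KAs] mcs_Bot[OF assms] by simp
    next
      case False
      then obtain B where "B \<in> set Bs" "NobodyProves B \<in> S"
        using mcs_Disjs[OF assms mcs_imp[OF assms R4[OF False prov] KAs]] by auto
      then show False
        using Bs T(2) NobodyProves_mcs[OF assms] by blast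
    qed
  qed
  then show ?thesis
    using Lindenbaum[of "boxed Know S \<union> ?P"] by blast
qed

text \<open>The canonical form of A3. An inconsistency would involve, for each agent
  \<open>j\<close>, one formula \<open>a j\<close> with \<open>Stit j (a j)\<close> in
  \<open>f j\<close>, hence possible in \<open>S\<close>. A3 makes these jointly possible, and the
  resulting set \<open>D\<close> contains all premises of the inconsistency.\<close>

lemma agents_independent:
  fixes S :: "'ag::finite form set" and f :: "'ag \<Rightarrow> 'ag form set"
  assumes S: "mcs S" and f: "\<And>j. mcs (f j)" "\<And>j. boxed Box (f j) = boxed Box S"
  shows "\<exists>S'. mcs S' \<and> boxed Box S' = boxed Box S \<and>
    (\<forall>j. boxed (Stit j) S' = boxed (Stit j) (f j))"
proof -
  let ?U = "boxed Box S \<union> (\<Union>j. boxed (Stit j) (f j))"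
  have "\<not> entails ?U \<^bold>\<bottom>"
  proof
    assume "entails ?U \<^bold>\<bottom>"
    then obtain Cs where Cs: "set Cs \<subseteq> ?U" "\<turnstile> Conjs Cs \<^bold>\<rightarrow> \<^bold>\<bottom>"
      unfolding entails_def by blast
    \<comment> \<open>A3 admits one formula per agent, so the finitely many premises of each agent
      are merged into a conjunction.\<close>
    define a where "a = (\<lambda>j. Conjs (filter (\<lambda>C. C \<in> boxed (Stit j) (f j)) Cs))"
    have a: "\<^bold>[j\<^bold>] a j \<in> f j" for j
    proof (rule normal_op_entails[OF mcs_closed[OF f(1)] s5_normal[OF s5_Stit]])
      show "entails (boxed (Stit j) (f j)) (a j)"
        unfolding entails_def a_def
        by (intro exI[of _ "filter (\<lambda>C. C \<in> boxed (Stit j) (f j)) Cs"] conjI provable_taut) auto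
    qed
    have "\<^bold>\<box> \<^bold>\<not> \<^bold>[j\<^bold>] a j \<notin> S" for j
      using a[of j] f(2)[of j] s5_boxed_refl[OF f(1) s5_Box, of j] mcs_Neg[OF f(1)]
      unfolding boxed_def by blast
    then have dia: "\<^bold>\<diamond> \<^bold>[j\<^bold>] a j \<in> S" for j
      using S by (simp add: mcs_Neg)
    let ?jAs = "map (\<lambda>j. (j, a j)) agents"
    have jAs: "?jAs \<noteq> []" "distinct (map fst ?jAs)"
      using agents[where 'ag = 'ag] by (auto simp: comp_def)
    have "Conjs (map (\<lambda>(j, A). \<^bold>\<diamond> \<^bold>[j\<^bold>] A) ?jAs) \<in> S"
      using dia S by (auto simp: closed_theory_Conjs mcs_closed)
    then have "\<^bold>\<diamond> Conjs (map (\<lambda>(j, A). \<^bold>[j\<^bold>] A) ?jAs) \<in> S"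
      using mcs_imp[OF S Ax[OF A3[OF jAs]]] by blast
    then have "\<^bold>\<box> \<^bold>\<not> Conjs (map (\<lambda>(j, A). \<^bold>[j\<^bold>] A) ?jAs) \<notin> S"
      using S by (simp add: mcs_Neg)
    from normal_op_witness[OF S s5_normal[OF s5_Box] this]
    obtain D where D: "mcs D" "boxed Box S \<subseteq> D" "Conjs (map (\<lambda>(j, A). \<^bold>[j\<^bold>] A) ?jAs) \<in> D"
      by (auto simp: mcs_Neg)
    then have "\<^bold>[j\<^bold>] a j \<in> D" for j
      by (auto simp: closed_theory_Conjs mcs_closed agents)
    then have "a j \<in> D" for j
      using s5_boxed_refl[OF D(1) s5_Stit] unfolding boxed_def by blast
    then have "set Cs \<inter> boxed (Stit j) (f j) \<subseteq> D" for j
      using D(1) unfolding a_def by (auto simp: closed_theory_Conjs mcs_closed)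
    then have "set Cs \<subseteq> D"
      using Cs(1) D(2) by blast
    then show False
      using closed_theory_Conjs[OF mcs_closed[OF D(1)]] mcs_imp[OF D(1) Cs(2)] mcs_Bot[OF D(1)]
      by blast
  qed
  then obtain S' where S': "mcs S'" "?U \<subseteq> S'"
    using Lindenbaum by blast
  have "boxed Box S = boxed Box S'"
    using S' by (intro s5_boxed_eq[OF S _ s5_Box]) auto
  moreover have "boxed (Stit j) (f j) = boxed (Stit j) S'" for j
    using S' by (intro s5_boxed_eq[OF f(1) _ s5_Stit]) auto
  ultimately show ?thesis
    using S'(1) by metis
qed

section \<open>Soundness\<close>

lemma jstit_modelD:
  assumes "jstit_model M"
  shows "partial_order_on (Tree M) (Le M)"
    and "\<forall>m\<in>Tree M. \<forall>j. partition_on (HistAt M m) (Choice M m j)"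
    and "preorder_on (Tree M) (Rel M)"
    and "\<forall>m\<in>Tree M. \<forall>m1\<in>Tree M. \<forall>m2\<in>Tree M.
      (m1, m) \<in> Le M \<longrightarrow> (m2, m) \<in> Le M \<longrightarrow> (m1, m2) \<in> Le M \<or> (m2, m1) \<in> Le M"
    and "\<forall>m\<in>Tree M. \<forall>f. (\<forall>j. f j \<in> Choice M m j) \<longrightarrow> (\<Inter>j. f j) \<noteq> {}"
    and "\<forall>m m' t. (m, m') \<in> Rel M \<longrightarrow> Evid M m t \<subseteq> Evid M m' t"
    and "\<forall>m\<in>Tree M. \<forall>s t A B.
      (A \<^bold>\<rightarrow> B \<in> Evid M m s \<longrightarrow> A \<in> Evid M m t \<longrightarrow> B \<in> Evid M m (s \<^bold>\<times> t)) \<and>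
      Evid M m s \<union> Evid M m t \<subseteq> Evid M m (s \<^bold>+ t) \<and>
      (A \<in> Evid M m t \<longrightarrow> t \<^bold>: A \<in> Evid M m (\<^bold>! t))"
    and "\<forall>m\<in>Tree M. \<forall>m'\<in>Tree M. (m', m) \<in> Lt M \<longrightarrow>
      (\<forall>h\<in>HistAt M m. Act M m' h \<subseteq> Act M m h)"
    and "\<forall>m\<in>Tree M. \<forall>h\<in>HistAt M m. \<forall>h'\<in>HistAt M m.
      (\<exists>m'\<in>h \<inter> h'. (m, m') \<in> Lt M) \<longrightarrow> Act M m h = Act M m h'"
    and "Le M \<subseteq> Rel M"
    and "\<forall>m m'. (m, m') \<in> Rel M \<longrightarrow>
      (\<Inter>h\<in>HistAt M m. Act M m h) \<subseteq> (\<Inter>h'\<in>HistAt M m'. Act M m' h')"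
  using assms unfolding jstit_model_def by - (elim conjE, assumption)+

text \<open>Separate from \<open>jstit\<close>, so that the facts on histories are available for the
  canonical tree before it is known to be a model.\<close>

locale backward_linear =
  fixes M :: "('m, 'ag) jstit_structure"
  assumes po: "partial_order_on (Tree M) (Le M)"
    and linear: "\<And>m m1 m2. m \<in> Tree M \<Longrightarrow> m1 \<in> Tree M \<Longrightarrow> m2 \<in> Tree M \<Longrightarrow>
      (m1, m) \<in> Le M \<Longrightarrow> (m2, m) \<in> Le M \<Longrightarrow> (m1, m2) \<in> Le M \<or> (m2, m1) \<in> Le M"
begin

lemma Le_refl: "m \<in> Tree M \<Longrightarrow> (m, m) \<in> Le M"
  using po unfolding partial_order_on_def preorder_on_def refl_on_def by blast

lemma Le_trans: "(m, m') \<in> Le M \<Longrightarrow> (m', m'') \<in> Le M \<Longrightarrow> (m, m'') \<in> Le M"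
  using po unfolding partial_order_on_def preorder_on_def trans_def by blast

lemma HistD:
  assumes "h \<in> Hist M"
  shows "h \<subseteq> Tree M" and "\<And>x y. x \<in> h \<Longrightarrow> y \<in> h \<Longrightarrow> (x, y) \<in> Le M \<or> (y, x) \<in> Le M"
  using assms unfolding Hist_def pred_on.maxchain_def pred_on.chain_def
  by (auto intro: Le_refl)

lemma Hist_max:
  assumes h: "h \<in> Hist M" and m: "m \<in> Tree M"
    and comp: "\<And>x. x \<in> h \<Longrightarrow> (x, m) \<in> Le M \<or> (m, x) \<in> Le M"
  shows "m \<in> h"
proof (rule ccontr)
  assume "m \<notin> h"
  have "pred_on.chain (Tree M) (\<lambda>m m'. (m, m') \<in> Le M) (insert m h)"
    unfolding pred_on.chain_def using HistD[OF h] m comp by blast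
  then show False
    using h \<open>m \<notin> h\<close> unfolding Hist_def pred_on.maxchain_def by blast
qed

text \<open>Backward linearity makes \<open>m'\<close> comparable with every element of
  \<open>h\<close>, and maximality of \<open>h\<close> then puts it into \<open>h\<close>.\<close>

lemma Hist_down:
  assumes h: "h \<in> Hist M" and m: "m \<in> h" "(m', m) \<in> Le M" "m' \<in> Tree M"
  shows "m' \<in> h"
proof (rule Hist_max[OF h m(3)])
  fix x assume x: "x \<in> h"
  from HistD(2)[OF h x m(1)] show "(x, m') \<in> Le M \<or> (m', x) \<in> Le M"
    using linear[of m x m'] m HistD(1)[OF h] x Le_trans by blast
qed

end

locale jstit =
  fixes M :: "('m, 'ag::finite) jstit_structure"
  assumes model: "jstit_model M"
begin

lemmas modelD = jstit_modelD[OF model]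

sublocale backward_linear M
proof
  show "partial_order_on (Tree M) (Le M)" by (rule modelD(1))
  show "(m1, m2) \<in> Le M \<or> (m2, m1) \<in> Le M"
    if "m \<in> Tree M" "m1 \<in> Tree M" "m2 \<in> Tree M" "(m1, m) \<in> Le M" "(m2, m) \<in> Le M" for m m1 m2
    using modelD(4)[rule_format, OF that] .
qed

lemma Rel_in_Tree: "(m, m') \<in> Rel M \<Longrightarrow> m \<in> Tree M \<and> m' \<in> Tree M"
  using modelD(3) unfolding preorder_on_def by blast

lemma Rel_refl: "m \<in> Tree M \<Longrightarrow> (m, m) \<in> Rel M"
  using modelD(3) unfolding preorder_on_def refl_on_def by blast

lemma Rel_trans: "(m, m') \<in> Rel M \<Longrightarrow> (m', m'') \<in> Rel M \<Longrightarrow> (m, m'') \<in> Rel M"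
  using modelD(3) unfolding preorder_on_def trans_def by blast

lemma MH_iff: "(m, h) \<in> MH M \<longleftrightarrow> m \<in> Tree M \<and> h \<in> HistAt M m"
  by (simp add: MH_def)

text \<open>All of \<open>h\<close> lies below \<open>m\<close>, hence in \<open>h'\<close> by
  downward closure, and maximality of \<open>h\<close> excludes a proper extension.\<close>

lemma HistAt_unique_if_last:
  assumes m: "m \<in> Tree M" and h: "h \<in> HistAt M m" "h' \<in> HistAt M m"
    and last: "\<And>m'. m' \<in> h \<Longrightarrow> (m, m') \<notin> Lt M"
  shows "h' = h"
proof -
  have below: "(x, m) \<in> Le M" if "x \<in> h" for x
    using HistD(2)[of h x m] h(1) that last[OF that] Le_refl[OF m]
    unfolding HistAt_def Lt_def by auto
  have sub: "h \<subseteq> h'"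
    using below Hist_down h HistD(1) unfolding HistAt_def by blast
  have "h' \<subseteq> h"
  proof
    fix x assume x: "x \<in> h'"
    show "x \<in> h"
    proof (rule Hist_max)
      show "h \<in> Hist M" "x \<in> Tree M"
        using h x HistD(1) unfolding HistAt_def by blast+
      show "(y, x) \<in> Le M \<or> (x, y) \<in> Le M" if "y \<in> h" for y
        using that x sub HistD(2)[of h' y x] h(2) unfolding HistAt_def by blast
    qed
  qed
  with sub show ?thesis by blast
qed

lemma cell:
  assumes m: "m \<in> Tree M" and h: "h \<in> HistAt M m"
  shows cell_in_Choice: "cell M m j h \<in> Choice M m j"
    and cell_self: "h \<in> cell M m j h"
    and cell_eqI: "\<And>c. c \<in> Choice M m j \<Longrightarrow> h \<in> c \<Longrightarrow> cell M m j h = c"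
proof -
  note P = modelD(2)[rule_format, OF m, of j, unfolded partition_on_def disjoint_def]
  have ex: "\<exists>!c. c \<in> Choice M m j \<and> h \<in> c"
    using P h by blast
  show "cell M m j h \<in> Choice M m j" "h \<in> cell M m j h"
    using theI'[OF ex] unfolding cell_def by blast+
  show "cell M m j h = c" if "c \<in> Choice M m j" "h \<in> c" for c
    using ex that unfolding cell_def by (intro the1_equality) auto
qed

lemma cell_sub: "m \<in> Tree M \<Longrightarrow> h \<in> HistAt M m \<Longrightarrow> h' \<in> cell M m j h \<Longrightarrow> h' \<in> HistAt M m"
  using cell_in_Choice[of m h j] modelD(2)[rule_format, of m j] unfolding partition_on_def by blast

lemma cell_cong:
  "m \<in> Tree M \<Longrightarrow> h \<in> HistAt M m \<Longrightarrow> h' \<in> cell M m j h \<Longrightarrow> cell M m j h' = cell M m j h"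
  using cell_in_Choice cell_sub cell_eqI by blast

lemma Evid_closed:
  assumes "m \<in> Tree M"
  shows "A \<^bold>\<rightarrow> B \<in> Evid M m s \<Longrightarrow> A \<in> Evid M m t \<Longrightarrow> B \<in> Evid M m (s \<^bold>\<times> t)"
    and "A \<in> Evid M m s \<Longrightarrow> A \<in> Evid M m (s \<^bold>+ t)"
    and "A \<in> Evid M m t \<Longrightarrow> A \<in> Evid M m (s \<^bold>+ t)"
    and "A \<in> Evid M m t \<Longrightarrow> t \<^bold>: A \<in> Evid M m (\<^bold>! t)"
  using modelD(7)[rule_format, OF assms, of A B s t] by blast+

lemma sat_Conjs: "sat M (Conjs As) m h \<longleftrightarrow> (\<forall>A\<in>set As. sat M A m h)"
  by (induction As rule: Conjs.induct) (auto simp: Bot_def)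

lemma sat_Disjs: "sat M (Disjs As) m h \<longleftrightarrow> (\<exists>A\<in>set As. sat M A m h)"
  by (induction As rule: Disjs.induct) (auto simp: Bot_def)

lemma sat_NobodyProves: "sat M (NobodyProves A) m h \<longleftrightarrow> (\<forall>j. \<not> sat M (Prove j A) m h)"
  by (simp add: NobodyProves_def sat_Conjs agents del: sat.simps(8))

text \<open>Truth at a fixed moment and history is a propositional valuation; this yields soundness
  of A0.\<close>

lemma bool_val_sat: "bool_val (\<lambda>B. sat M B m h) A \<longleftrightarrow> sat M A m h"
  by (induction A) auto

lemma knows_mono: "(m, m') \<in> Rel M \<Longrightarrow> knows M P m \<Longrightarrow> knows M P m'"
  unfolding knows_def using Rel_trans by blast

lemma justified_mono: "(m, m') \<in> Rel M \<Longrightarrow> justified M t A P m \<Longrightarrow> justified M t A P m'"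
  unfolding justified_def using knows_mono modelD(6)[rule_format] by blast

text \<open>Shared proofs and their evidence persist along \<open>Rel\<close>. Without a history
  through \<open>m\<close>, \<open>Proven A\<close> would hold there vacuously, which the last
  hypothesis excludes.\<close>

lemma sat_Proven_mono:
  assumes "(m, m') \<in> Rel M" "sat M (Proven A) m h" "HistAt M m \<noteq> {}"
  shows "sat M (Proven A) m' h'"
proof -
  obtain t where "\<forall>h'\<in>HistAt M m. t \<in> Act M m h' \<and> justified M t A (sat M A) m"
    using assms(2) by auto
  then have "\<forall>h'\<in>HistAt M m'. t \<in> Act M m' h' \<and> justified M t A (sat M A) m'"
    using modelD(11)[rule_format, OF assms(1)] justified_mono[OF assms(1)] assms(3) by blast
  then show ?thesis by auto
qed

lemma sat_Prove_not_Proven: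
  assumes "h \<in> HistAt M m" "sat M (Prove j A) m h"
  shows "\<not> sat M (Proven A) m h'"
  using assms by auto

lemma sat_Prove_witness:
  assumes "m \<in> Tree M" "h \<in> HistAt M m" "sat M (Prove j A) m h"
  shows "\<exists>t\<in>Act M m h. justified M t A (sat M A) m"
  using assms(3) cell_self[OF assms(1,2)] by auto

lemma sat_Prove_next_moment:
  assumes m: "m \<in> Tree M" and h: "h \<in> HistAt M m" and P: "sat M (Prove j A) m h"
  shows "\<exists>m'\<in>h. (m, m') \<in> Lt M"
proof (rule ccontr)
  assume last: "\<not> (\<exists>m'\<in>h. (m, m') \<in> Lt M)"
  obtain t where t: "t \<in> Act M m h" "justified M t A (sat M A) m"
    using sat_Prove_witness[OF assms] by blast
  then obtain h'' where "h'' \<in> HistAt M m" "t \<notin> Act M m h''"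
    using P by auto
  then show False
    using HistAt_unique_if_last[OF m h] last t(1) by blast
qed

lemma Lt_Rel: "(m, m') \<in> Lt M \<Longrightarrow> (m, m') \<in> Rel M"
  using modelD(10) unfolding Lt_def by blast

text \<open>All histories through \<open>m'\<close> are undivided at \<open>m\<close>, so the proof
  presented there on \<open>h\<close> is presented on each of them, and it stays presented at
  \<open>m'\<close>.\<close>

lemma sat_Prove_next_Proven:
  assumes m: "m \<in> Tree M" and h: "h \<in> HistAt M m" and P: "sat M (Prove j A) m h"
    and m': "m' \<in> h" "(m, m') \<in> Lt M"
  shows "sat M (Proven A) m' h'"
proof -
  obtain t where t: "t \<in> Act M m h" "justified M t A (sat M A) m"
    using sat_Prove_witness[OF m h P] by blast
  have R: "(m, m') \<in> Rel M" and m'T: "m' \<in> Tree M"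
    using Lt_Rel[OF m'(2)] Rel_in_Tree by blast+
  have "t \<in> Act M m' h''" if h'': "h'' \<in> HistAt M m'" for h''
  proof -
    have "h'' \<in> HistAt M m"
      using h'' m'(2) Hist_down[of h'' m' m] m unfolding HistAt_def Lt_def by blast
    moreover from this have "Act M m h'' = Act M m h"
      using modelD(9)[rule_format, OF m _ h, of h''] h'' m' unfolding HistAt_def by blast
    ultimately show ?thesis
      using modelD(8)[rule_format, OF m'T m m'(2) h''] t(1) by blast
  qed
  then show ?thesis
    using justified_mono[OF R t(2)] by auto
qed

text \<open>The semantic content of A12. Where \<open>Prove j A\<close> holds, some later moment has
  \<open>Proven A\<close>; this persists along \<open>Rel\<close> and excludes
  \<open>Prove j A\<close> for good. The listed formulas are exhausted one after another in this
  way.\<close>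

lemma no_more_Prove:
  assumes "m \<in> Tree M" "HistAt M m \<noteq> {}"
  shows "\<exists>m'. (m, m') \<in> Rel M \<and> HistAt M m' \<noteq> {} \<and>
    (\<forall>(j, A)\<in>set jAs. \<forall>m'' h''. (m', m'') \<in> Rel M \<longrightarrow> h'' \<in> HistAt M m'' \<longrightarrow>
      \<not> sat M (Prove j A) m'' h'')"
proof (induction jAs)
  case Nil
  then show ?case using assms Rel_refl by auto
next
  case (Cons jA jAs)
  obtain j A where jA: "jA = (j, A)" by fastforce
  obtain m' where m': "(m, m') \<in> Rel M" "HistAt M m' \<noteq> {}"
    and none: "\<And>i B m'' h''. (i, B) \<in> set jAs \<Longrightarrow> (m', m'') \<in> Rel M \<Longrightarrow> h'' \<in> HistAt M m'' \<Longrightarrow>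
      \<not> sat M (Prove i B) m'' h''"
    using Cons by fastforce
  show ?case
  proof (cases "\<exists>m'' h''. (m', m'') \<in> Rel M \<and> h'' \<in> HistAt M m'' \<and> sat M (Prove j A) m'' h''")
    case False
    then show ?thesis
      using m' none jA by (intro exI[of _ m']) (auto simp del: sat.simps(8))
  next
    case True
    then obtain m1 h1 where m1: "(m', m1) \<in> Rel M" "h1 \<in> HistAt M m1" "sat M (Prove j A) m1 h1"
      by blast
    then have m1T: "m1 \<in> Tree M" using Rel_in_Tree by blast
    obtain m2 where m2: "m2 \<in> h1" "(m1, m2) \<in> Lt M"
      using sat_Prove_next_moment[OF m1T m1(2,3)] by blast
    have h1: "h1 \<in> HistAt M m2"
      using m2 m1(2) unfolding HistAt_def by blast
    have R: "(m', m2) \<in> Rel M"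
      using Rel_trans[OF m1(1) Lt_Rel[OF m2(2)]] .
    have "\<not> sat M (Prove j A) m3 h3" if "(m2, m3) \<in> Rel M" "h3 \<in> HistAt M m3" for m3 h3
      using sat_Proven_mono[OF that(1) sat_Prove_next_Proven[OF m1T m1(2,3) m2]] h1
        sat_Prove_not_Proven[OF that(2)] by blast
    moreover have "\<not> sat M (Prove i B) m3 h3"
      if "(i, B) \<in> set jAs" "(m2, m3) \<in> Rel M" "h3 \<in> HistAt M m3" for i B m3 h3
      using none[OF that(1) Rel_trans[OF R that(2)] that(3)] .
    ultimately show ?thesis
      using Rel_trans[OF m'(1) R] h1 jA by (intro exI[of _ m2]) (auto simp del: sat.simps(8))
  qed
qed

text \<open>Each listed agent contributes a cell where its formula holds, every other agent the cell
  of \<open>h\<close>; independence of choices gives a history common to all of them.\<close>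

lemma sat_A3:
  assumes m: "m \<in> Tree M" and "distinct (map fst jAs)"
    and dia: "\<And>j A. (j, A) \<in> set jAs \<Longrightarrow> sat M (\<^bold>\<diamond> \<^bold>[j\<^bold>] A) m h"
    and h: "h \<in> HistAt M m"
  shows "\<exists>h'\<in>HistAt M m. \<forall>(j, A)\<in>set jAs. sat M (\<^bold>[j\<^bold>] A) m h'"
proof -
  have "\<exists>c\<in>Choice M m j. \<forall>A. (j, A) \<in> set jAs \<longrightarrow> (\<forall>h'\<in>c. sat M A m h')" for j
  proof (cases "\<exists>A. (j, A) \<in> set jAs")
    case True
    then obtain A where A: "(j, A) \<in> set jAs" by blast
    then have uniq: "B = A" if "(j, B) \<in> set jAs" for B
      using that assms(2) by (metis eq_key_imp_eq_value)
    obtain h' where h': "h' \<in> HistAt M m" "\<forall>h''\<in>cell M m j h'. sat M A m h''"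
      using dia[OF A] by auto
    then show ?thesis
      using cell_in_Choice[OF m h'(1), of j] uniq by blast
  next
    case False
    then show ?thesis
      using cell_in_Choice[OF m h, of j] by blast
  qed
  then obtain f where f: "\<And>j. f j \<in> Choice M m j"
      "\<And>j A h'. (j, A) \<in> set jAs \<Longrightarrow> h' \<in> f j \<Longrightarrow> sat M A m h'"
    by metis
  obtain h' where h': "h' \<in> f j" for j
    using modelD(5)[rule_format, OF m, of f] f(1) by blast
  have "h' \<in> HistAt M m"
    using h' f(1) modelD(2)[rule_format, OF m] unfolding partition_on_def by blast
  moreover from this have "cell M m j h' = f j" for j
    using cell_eqI[OF m _ f(1) h'] by blast
  ultimately show ?thesis
    using f(2) by (intro bexI[of _ h']) auto
qed

text \<open>If \<open>A\<close> is proven, nobody proves it anywhere at \<open>m\<close>. Otherwise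
  only the first clause of \<open>Prove\<close> can fail, so the cell contains a history that
  presents no proof of \<open>A\<close>, and there \<open>Prove i A\<close> fails for every
  \<open>i\<close>.\<close>

lemma sat_A13:
  assumes m: "m \<in> Tree M" and h: "h \<in> HistAt M m" and "\<not> sat M (Prove j A) m h"
  shows "\<exists>h'\<in>cell M m j h. \<forall>i. \<not> sat M (Prove i A) m h'"
proof (cases "sat M (Proven A) m h")
  case True
  then have "\<not> sat M (Prove i A) m h" for i
    using sat_Prove_not_Proven[OF h] by blast
  then show ?thesis using cell_self[OF m h] by blast
next
  case False
  then obtain h' where h': "h' \<in> cell M m j h" "\<forall>t\<in>Act M m h'. \<not> justified M t A (sat M A) m"
    using assms(3) by auto
  then have "\<not> sat M (Prove i A) m h'" for i
    using sat_Prove_witness[OF m cell_sub[OF m h h'(1)]] by blast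
  then show ?thesis using h'(1) by blast
qed

lemma axiom_sound:
  assumes "axiom_inst A" "m \<in> Tree M" "h \<in> HistAt M m"
  shows "sat M A m h"
  using assms
proof (induction arbitrary: h rule: axiom_inst.induct)
  case (A0 A)
  then show ?case using bool_val_sat unfolding tautology_def by blast
next
  case (A1_Stit_5 j A)
  then show ?case using cell_cong by auto
next
  case (A1_Stit_4 j A)
  then show ?case using cell_cong by auto
next
  case (A1_Stit_T j A)
  then show ?case using cell_self by auto
next
  case (A2 A j)
  then show ?case using cell_sub by auto
next
  case (A3 jAs)
  have "sat M (\<^bold>\<diamond> Conjs (map (\<lambda>(j, A). \<^bold>[j\<^bold>] A) jAs)) m h"
    if "sat M (Conjs (map (\<lambda>(j, A). \<^bold>\<diamond> \<^bold>[j\<^bold>] A) jAs)) m h"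
  proof -
    have "\<exists>h'\<in>HistAt M m. \<forall>(j, A)\<in>set jAs. sat M (\<^bold>[j\<^bold>] A) m h'"
    proof (rule sat_A3[OF A3.prems(1) A3.hyps(2) _ A3.prems(2)])
      show "sat M (\<^bold>\<diamond> \<^bold>[j\<^bold>] A) m h" if "(j, A) \<in> set jAs" for j A
        using \<open>sat M (Conjs _) m h\<close> that unfolding sat_Conjs by force
    qed
    then show ?thesis
      by (fastforce simp: sat_Conjs)
  qed
  then show ?case by (simp only: sat.simps) blast
next
  case (A4 s A B t)
  then show ?case
    using Evid_closed(1)[OF A4.prems(1)] by (auto simp: justified_def knows_def)
next
  case (A5 t A)
  have "justified M (\<^bold>! t) (t \<^bold>: A) (sat M (t \<^bold>: A)) m" "knows M (sat M A) m"
    if t: "justified M t A (sat M A) m"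
  proof -
    have "t \<^bold>: A \<in> Evid M m (\<^bold>! t)"
      using t Evid_closed(4)[OF A5.prems(1)] unfolding justified_def by blast
    moreover have "knows M (sat M (t \<^bold>: A)) m"
      using justified_mono[OF _ t] unfolding knows_def[of M "sat M (t \<^bold>: A)"] by simp
    ultimately show "justified M (\<^bold>! t) (t \<^bold>: A) (sat M (t \<^bold>: A)) m"
      unfolding justified_def[of M "\<^bold>! t"] by blast
    show "knows M (sat M A) m"
      using t unfolding justified_def by blast
  qed
  then show ?case by auto
next
  case (A6 s A t)
  then show ?case
    using Evid_closed(2,3)[OF A6.prems(1)] by (auto simp: justified_def)
next
  case (A7_T A)
  then show ?case using Rel_refl by (auto simp: knows_def)
next
  case (A7_4 A)
  have "knows M (sat M (\<^bold>K A)) m" if "knows M (sat M A) m"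
    using knows_mono[OF _ that] unfolding knows_def[of M "sat M (\<^bold>K A)"] by simp
  then show ?case by auto
next
  case (A8 A)
  then show ?case using Rel_trans by (auto simp: knows_def)
next
  case (A9 j A)
  have "sat M (\<^bold>[j\<^bold>] Prove j A) m h" "sat M (\<^bold>K A) m h" if "sat M (Prove j A) m h"
    using that cell_cong[OF A9] sat_Prove_witness[OF A9 that] by (auto simp: justified_def)
  then show ?case
    using sat_Prove_not_Proven[OF A9(2)] by (simp only: sat.simps) blast
next
  case (A10 j A i)
  \<comment> \<open>If \<open>Prove j A\<close> holds on all histories, each of them presents a
    proof of \<open>A\<close>, which is the first clause for any agent; the second clause does not
    mention the agent.\<close>
  have "sat M (Prove i A) m h'"
    if "\<forall>h\<in>HistAt M m. sat M (Prove j A) m h" "h' \<in> HistAt M m" for h'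
    using that sat_Prove_witness[OF A10(1), of _ j A] cell_sub[OF A10(1) that(2)] by auto
  then show ?case by (simp only: sat.simps) blast
next
  case (A11 A)
  have "sat M (\<^bold>K Proven A) m h" if "sat M (Proven A) m h"
  proof -
    have "HistAt M m \<noteq> {}" using A11(2) by blast
    then show ?thesis
      using sat_Proven_mono[OF _ that] unfolding sat.simps(7) knows_def by blast
  qed
  moreover have "sat M (\<^bold>K A) m h" if "sat M (Proven A) m h"
    using that A11(2) by (auto simp: justified_def)
  ultimately show ?case by (simp only: sat.simps) blast
next
  case (A12 jAs)
  obtain m' where m': "(m, m') \<in> Rel M" "HistAt M m' \<noteq> {}" and none:
    "\<forall>(j, A)\<in>set jAs. \<forall>m'' h''. (m', m'') \<in> Rel M \<longrightarrow> h'' \<in> HistAt M m'' \<longrightarrow> \<not> sat M (Prove j A) m'' h''"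
    using no_more_Prove[OF A12.prems(1), of jAs] A12.prems(2) by blast
  then show ?case
    by (fastforce simp: knows_def sat_Disjs simp del: sat.simps(8))
next
  case (A13 j A)
  then show ?case
    using sat_A13[OF A13] by (auto simp: sat_NobodyProves simp del: sat.simps(8))
qed (auto simp: knows_def)

lemma sound:
  assumes "normal M" "\<turnstile> A" "m \<in> Tree M" "h \<in> HistAt M m"
  shows "sat M A m h"
  using assms(2-)
proof (induction arbitrary: m h rule: provable.induct)
  case (Ax A)
  then show ?case using axiom_sound by blast
next
  case (R1 A B)
  then show ?case by simp
next
  case (R2 A)
  then show ?case using Rel_in_Tree by (auto simp: knows_def)
next
  case (R3 A c)
  then show ?case
    using assms(1) axiom_sound Rel_in_Tree unfolding normal_def
    by (auto simp: justified_def knows_def)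
next
  case (R4 Bs A)
  show ?case
  proof (rule ccontr)
    assume "\<not> ?case"
    then have K: "sat M (\<^bold>K A) m h" and "\<forall>B\<in>set Bs. \<exists>j. sat M (Prove j B) m h"
      by (auto simp: sat_Disjs sat_NobodyProves simp del: sat.simps(8))
    then obtain j where j: "\<And>B. B \<in> set Bs \<Longrightarrow> sat M (Prove (j B) B) m h"
      by metis
    \<comment> \<open>One later moment on \<open>h\<close> serves for all members of
      \<open>Bs\<close> at once; it comes from any single one, and R4 demands a nonempty
      list.\<close>
    obtain m' where m': "m' \<in> h" "(m, m') \<in> Lt M"
      using sat_Prove_next_moment[OF R4.prems j] R4.hyps(1) by (meson last_in_set)
    have R: "(m, m') \<in> Rel M"
      using Lt_Rel m'(2) by blast
    then have "sat M (\<^bold>K A) m' h"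
      using K knows_mono by simp
    moreover have "sat M (Proven B) m' h" if "B \<in> set Bs" for B
      using sat_Prove_next_Proven[OF R4.prems j[OF that] m'] .
    moreover have "m' \<in> Tree M" "h \<in> HistAt M m'"
      using Rel_in_Tree[OF R] R4.prems m' unfolding HistAt_def by auto
    ultimately show False
      using R4.IH[of m' h] by (auto simp: sat_Disjs simp del: sat.simps(9))
  qed
qed

end

lemma satisfiable_consistent:
  fixes \<Gamma> :: "'ag::finite form set"
  assumes "satisfiable TYPE('m) \<Gamma>"
  shows "consistent \<Gamma>"
proof -
  obtain M :: "('m, 'ag) jstit_structure" and m h where M: "jstit_model M" "normal M"
    and mh: "(m, h) \<in> MH M" and sat: "\<forall>A\<in>\<Gamma>. sat M A m h"
    using assms unfolding satisfiable_def by blast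
  interpret jstit M by (rule jstit.intro[OF M(1)])
  have "\<not> (\<turnstile> Conjs As \<^bold>\<rightarrow> \<^bold>\<bottom>)" if "set As \<subseteq> \<Gamma>" for As
    using sound[OF M(2), of "Conjs As \<^bold>\<rightarrow> \<^bold>\<bottom>" m h] mh sat that
    by (auto simp: MH_iff sat_Conjs Bot_def)
  then show ?thesis
    unfolding consistent_def inconsistent_def by blast
qed

section \<open>Trees of lists\<close>

text \<open>Time runs from the end of a list to its front, so that \<^term>\<open>b # w\<close> is an immediate successor
  of \<^term>\<open>w\<close>.\<close>

definition step :: "'b list set set \<Rightarrow> 'b list \<Rightarrow> 'b" where
  "step h w = (THE b. {b # w} \<in> h)"

text \<open>Moments are singletons only to fit the type \<open>'ag moment\<close> of sets of lists;
  no lists are identified. \<open>W_extend\<close> excludes last moments, so that every history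
  takes a further step.\<close>

locale list_tree =
  fixes W :: "'b list set" and M :: "('b list set, 'ag) jstit_structure"
  assumes W_Cons: "b # w \<in> W \<Longrightarrow> w \<in> W"
    and W_extend: "w \<in> W \<Longrightarrow> \<exists>b. b # w \<in> W"
    and Tree: "Tree M = (\<lambda>w. {w}) ` W"
    and Le: "Le M = {({v}, {w}) |v w. v \<in> W \<and> w \<in> W \<and> suffix v w}"
begin

lemma Le_iff: "({v}, {w}) \<in> Le M \<longleftrightarrow> v \<in> W \<and> w \<in> W \<and> suffix v w"
  by (auto simp: Le)

lemma W_suffix: "suffix v w \<Longrightarrow> w \<in> W \<Longrightarrow> v \<in> W"
  by (induction w) (auto simp: suffix_Cons dest: W_Cons)

sublocale backward_linear M
proof
  have "Le M \<subseteq> Tree M \<times> Tree M" "refl_on (Tree M) (Le M)"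
    by (auto simp: Tree Le refl_on_def)
  moreover have "trans (Le M)"
    by (rule transI, clarsimp simp: Le) (erule (1) suffix_order.trans)
  moreover have "antisym (Le M)"
    by (rule antisymI, clarsimp simp: Le) (erule (1) suffix_order.antisym)
  ultimately show "partial_order_on (Tree M) (Le M)"
    by (simp add: partial_order_on_def preorder_on_def)
  show "(m1, m2) \<in> Le M \<or> (m2, m1) \<in> Le M" if le: "(m1, m) \<in> Le M" "(m2, m) \<in> Le M" for m m1 m2
  proof -
    obtain v1 w where v1: "m1 = {v1}" "m = {w}" "v1 \<in> W" "suffix v1 w"
      using le(1) unfolding Le by blast
    moreover obtain v2 where "m2 = {v2}" "v2 \<in> W" "suffix v2 w"
      using le(2) v1(2) unfolding Le by blast
    ultimately show ?thesis
      using suffix_same_cases[of v1 w v2] by (auto simp: Le)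
  qed
qed

lemma Lt_iff: "({v}, {w}) \<in> Lt M \<longleftrightarrow> v \<in> W \<and> w \<in> W \<and> strict_suffix v w"
  by (auto simp: Lt_def Le_iff strict_suffix_def)

lemma strict_suffix_Cons: "strict_suffix v w \<Longrightarrow> \<exists>b. suffix (b # v) w"
proof (induction w)
  case (Cons a w)
  then show ?case
    by (cases "v = w") (auto simp: strict_suffix_def suffix_Cons)
qed auto

lemma Hist_suffix: "h \<in> Hist M \<Longrightarrow> {w} \<in> h \<Longrightarrow> suffix v w \<Longrightarrow> {v} \<in> h"
  using Hist_down[of h "{w}" "{v}"] HistD(1)[of h] W_suffix[of v w]
  by (auto simp: Le_iff Tree)

text \<open>Two one-step extensions of \<open>w\<close> on one history are comparable by suffix and
  equally long, hence equal; so the description in \<open>step\<close> is unique.\<close>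

lemma step_eq:
  assumes h: "h \<in> Hist M" and b: "{b # w} \<in> h"
  shows "step h w = b"
  unfolding step_def
proof (rule the_equality[of "\<lambda>b. {b # w} \<in> h", OF b])
  fix c assume "{c # w} \<in> h"
  then have "suffix (c # w) (b # w) \<or> suffix (b # w) (c # w)"
    using HistD(2)[OF h b \<open>{c # w} \<in> h\<close>] by (auto simp: Le_iff)
  then show "c = b"
    by (auto simp: suffix_Cons dest: suffix_ConsD')
qed

text \<open>If \<open>h\<close> had no step beyond \<open>w\<close>, all its members would be
  suffixes of \<open>w\<close>, and any extension of \<open>w\<close> in \<open>W\<close> could be
  added to it.\<close>

lemma step_in_Hist:
  assumes h: "h \<in> Hist M" and w: "{w} \<in> h"
  shows "{step h w # w} \<in> h"
proof -
  have "\<exists>b. {b # w} \<in> h"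
  proof (rule ccontr)
    assume no: "\<nexists>b. {b # w} \<in> h"
    have wW: "w \<in> W" using HistD(1)[OF h] w by (auto simp: Tree)
    have below: "\<exists>v. x = {v} \<and> v \<in> W \<and> suffix v w" if x: "x \<in> h" for x
    proof -
      obtain v where v: "x = {v}" "v \<in> W"
        using x HistD(1)[OF h] by (auto simp: Tree)
      have "\<not> strict_suffix w v"
        using strict_suffix_Cons[of w v] Hist_suffix[OF h, of v] x v no by blast
      then show ?thesis
        using HistD(2)[OF h x w] v by (auto simp: Le_iff strict_suffix_def)
    qed
    obtain b where b: "b # w \<in> W" using W_extend[OF wW] by blast
    have "{b # w} \<in> h"
    proof (rule Hist_max[OF h])
      show "{b # w} \<in> Tree M" using b by (simp add: Tree)
      show "(x, {b # w}) \<in> Le M \<or> ({b # w}, x) \<in> Le M" if "x \<in> h" for x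
        using below[OF that] b by (auto simp: Le_iff intro: suffix_ConsI)
    qed
    then show False using no by blast
  qed
  then show ?thesis using step_eq[OF h] by force
qed

lemma step_in_W: "h \<in> HistAt M {w} \<Longrightarrow> step h w # w \<in> W"
  using step_in_Hist[of h w] HistD(1)[of h] by (auto simp: HistAt_def Tree)

lemma step_suffix: "h \<in> HistAt M {w} \<Longrightarrow> suffix (b # v) w \<Longrightarrow> step h v = b"
  using step_eq Hist_suffix unfolding HistAt_def by blast

text \<open>Hausdorff's principle is applied only to the moments comparable with
  \<open>{b # w}\<close>. This forces that moment into the maximal chain, which is then maximal in
  the whole tree too.\<close>

lemma HistAt_exists:
  assumes "b # w \<in> W"
  shows "\<exists>h\<in>HistAt M {w}. step h w = b"
proof -
  let ?m = "{b # w}" and ?R = "\<lambda>m m'. (m, m') \<in> Le M"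
  let ?A = "{x \<in> Tree M. ?R x ?m \<or> ?R ?m x}"
  have m: "?m \<in> Tree M" using assms by (simp add: Tree)
  obtain h where h: "pred_on.maxchain ?A ?R h"
    using pred_on.Hausdorff by blast
  then have chain: "pred_on.chain ?A ?R h"
    unfolding pred_on.maxchain_def by blast
  have "pred_on.chain ?A ?R (insert ?m h)"
    using chain m Le_refl[OF m] unfolding pred_on.chain_def by blast
  then have mh: "?m \<in> h"
    using h unfolding pred_on.maxchain_def by blast
  have "pred_on.maxchain (Tree M) ?R h"
    unfolding pred_on.maxchain_def
  proof (intro conjI notI)
    show "pred_on.chain (Tree M) ?R h"
      using chain unfolding pred_on.chain_def by blast
  next
    assume "\<exists>S. pred_on.chain (Tree M) ?R S \<and> h \<subset> S"
    then obtain S where S: "pred_on.chain (Tree M) ?R S" "h \<subset> S" by blast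
    then have "S \<subseteq> ?A"
      using mh Le_refl unfolding pred_on.chain_def by blast
    then have "pred_on.chain ?A ?R S"
      using S(1) unfolding pred_on.chain_def by blast
    then show False
      using S(2) h unfolding pred_on.maxchain_def by blast
  qed
  then have hist: "h \<in> Hist M" by (simp add: Hist_def)
  then have "{w} \<in> h" "step h w = b"
    using mh Hist_suffix[OF hist mh, of w] step_eq by (auto intro: suffix_ConsI)
  then show ?thesis
    using hist unfolding HistAt_def by blast
qed

end

section \<open>The canonical model\<close>

instance pol :: countable
  by countable_datatype

text \<open>Formulas have to be numbered in order to receive fresh variables from the complement of
  \<open>X\<close>.\<close>

instance form :: (countable) countable
  by countable_datatype

text \<open>A token is a maximal consistent set together with one bit, encoded by membership of \<open>\<^bold>\<bottom>\<close>.\<close>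

definition nu :: "'ag form set \<Rightarrow> 'ag form set" where
  "nu b = b - {\<^bold>\<bottom>}"

definition token :: "'ag form set \<Rightarrow> bool \<Rightarrow> 'ag form set" where
  "token S i = (if i then insert \<^bold>\<bottom> S else S)"

definition idx :: "'ag form set \<Rightarrow> bool" where
  "idx b \<longleftrightarrow> \<^bold>\<bottom> \<in> b"

lemma token: "mcs S \<Longrightarrow> nu (token S i) = S" "mcs S \<Longrightarrow> idx (token S i) = i"
  using mcs_Bot[of S] by (auto simp: nu_def token_def idx_def)

definition succ :: "'ag::finite form set \<Rightarrow> 'ag form set" where
  "succ S = (SOME S'. mcs S' \<and> boxed Know S \<subseteq> S' \<and> (\<forall>j A. Prove j A \<in> S \<longrightarrow> Proven A \<in> S'))"

lemma succ:
  assumes "mcs S"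
  shows "mcs (succ S)" and "boxed Know S \<subseteq> succ S"
    and "\<And>j A. Prove j A \<in> S \<Longrightarrow> Proven A \<in> succ S"
  using someI_ex[OF successor_exists[OF assms]] unfolding succ_def by blast+

text \<open>The root is an auxiliary moment below all others, at which no truth lemma is claimed.\<close>

fun rep :: "'ag::finite form set list \<Rightarrow> 'ag form set" where
  "rep [] = {A. \<turnstile> A}"
| "rep [b] = nu b"
| "rep (b # c # w) = succ (nu b)"

text \<open>A new front entry is the choice of a history. At the root any maximal consistent set may
  be chosen, and it becomes the next label itself; elsewhere the choice is confined to the box class
  of \<open>rep w\<close>, and the next label is its \<open>succ\<close>.\<close>

primrec valid :: "'ag::finite form set list \<Rightarrow> bool" where
  "valid [] \<longleftrightarrow> True"
| "valid (b # w) \<longleftrightarrow> valid w \<and> mcs (nu b) \<and> (w \<noteq> [] \<longrightarrow> boxed Box (nu b) = boxed Box (rep w))"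

lemma rep_Cons: "w \<noteq> [] \<Longrightarrow> rep (b # w) = succ (nu b)"
  by (cases w) auto

lemma mcs_rep: "valid w \<Longrightarrow> w \<noteq> [] \<Longrightarrow> mcs (rep w)"
  by (induction w rule: rep.induct) (auto simp: succ)

lemma closed_rep: "valid w \<Longrightarrow> closed_theory (rep w)"
  by (cases "w = []") (simp_all add: closed_theory_theorems mcs_closed mcs_rep)

text \<open>The label \<open>rep w\<close> and the choice \<open>nu b\<close> lie in one box class
  and know the same formulas, and \<open>succ\<close> contains what \<open>nu b\<close> knows. At
  the root only theorems are known.\<close>

lemma rep_step:
  assumes "valid (b # w)"
  shows "boxed Know (rep w) \<subseteq> rep (b # w)"
proof (cases "w = []")
  case True
  then show ?thesis
    using assms Know_boxed_refl[OF closed_theory_theorems] closed_theory_provable[OF mcs_closed]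
    by auto
next
  case False
  then have "boxed Know (rep w) = boxed Know (nu b)"
    using Box_class_Know[of "rep w" "nu b"] assms mcs_rep[of w] by (auto simp: boxed_def)
  then show ?thesis
    using succ(2)[of "nu b"] assms rep_Cons[OF False] by simp
qed

lemma valid_suffix: "suffix v w \<Longrightarrow> valid w \<Longrightarrow> valid v"
  by (induction w) (auto simp: suffix_Cons)

lemma rep_suffix: "suffix v w \<Longrightarrow> valid w \<Longrightarrow> boxed Know (rep v) \<subseteq> rep w"
proof (induction w)
  case Nil
  then show ?case using Know_boxed_refl[OF closed_theory_theorems] by simp
next
  case (Cons b w)
  show ?case
  proof (cases "v = b # w")
    case True
    then show ?thesis using Know_boxed_refl[OF closed_rep[OF Cons.prems(2)]] by simp
  next
    case False
    then have v: "suffix v w" using Cons.prems(1) by (simp add: suffix_Cons)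
    have w: "valid w" using Cons.prems(2) by simp
    show ?thesis
      by (rule Know_boxed_trans[OF closed_rep[OF valid_suffix[OF v w]] Cons.IH[OF v w]
            rep_step[OF Cons.prems(2)]])
  qed
qed

lemma rep_token:
  assumes "mcs S" "w \<noteq> [] \<Longrightarrow> boxed Box S = boxed Box (rep w)" "valid w"
  shows "valid (token S i # w)"
  using assms by (simp add: token)

section \<open>A one-moment model in which no proof is presented\<close>

definition trivial_model :: "(unit, 'ag::finite) jstit_structure" where
  "trivial_model = \<lparr>Tree = {()}, Le = {((), ())}, Choice = \<lambda>_ _. {{{()}}}, Act = \<lambda>_ _. {},
    Rel = {((), ())}, Evid = \<lambda>_ _. UNIV, Val = \<lambda>_. {}\<rparr>"

lemma trivial_simps:
  "Tree trivial_model = {()}" "Le trivial_model = {((), ())}" "Rel trivial_model = {((), ())}"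
  "Choice trivial_model m j = {{{()}}}" "Act trivial_model m h = {}" "Val trivial_model p = {}"
  "Evid trivial_model m t = UNIV" "Lt trivial_model = {}"
  by (simp_all add: trivial_model_def Lt_def)

lemma HistAt_trivial: "HistAt trivial_model m = {{()}}"
proof -
  have "pred_on.maxchain {()} (\<lambda>m m'. (m, m') \<in> {((), ())}) h \<longleftrightarrow> h = {()}" for h
  proof (cases "h = {()}")
    case True
    then show ?thesis
      by (auto simp: pred_on.maxchain_def pred_on.chain_def)
  next
    case False
    then have "h = {}" by auto
    then have "\<not> pred_on.maxchain {()} (\<lambda>m m'. (m, m') \<in> {((), ())}) h"
      unfolding pred_on.maxchain_def pred_on.chain_def by auto
    then show ?thesis using False by blast
  qed
  then show ?thesis
    by (auto simp: HistAt_def Hist_def trivial_simps)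
qed

lemma trivial_model: "jstit_model trivial_model" "normal trivial_model"
  by (auto simp: jstit_model_def normal_def trivial_simps HistAt_trivial partial_order_on_def
      preorder_on_def refl_on_def trans_def antisym_def partition_on_def disjoint_def)

text \<open>By soundness, the truths of the trivial model form such a set; in particular the logic
  is consistent. In the canonical tree the set gives a history through the root on which nothing is
  presented there.\<close>

lemma mcs_without_Proven:
  "\<exists>S :: 'ag::finite form set. mcs S \<and> (\<forall>A. Proven A \<notin> S)"
proof -
  let ?S = "{A :: 'ag form. sat trivial_model A () {()}}"
  interpret jstit trivial_model by (rule jstit.intro[OF trivial_model(1)])
  have "sat trivial_model A () {()}" if "\<turnstile> A" for A :: "'ag form"
    by (rule sound[OF trivial_model(2) that]) (simp_all add: trivial_simps HistAt_trivial)
  then have "mcs ?S"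
    by (auto simp: mcs_def closed_theory_def)
  moreover have "Proven A \<notin> ?S" for A
    by (simp add: trivial_simps HistAt_trivial)
  ultimately show ?thesis by blast
qed

text \<open>Each formula receives four fresh variables: the first bit separates direct from delayed
  ones, the second is the index of a token that presents them.\<close>

locale canonical =
  fixes X :: "pvar set" and fr :: "'ag::finite form \<times> bool \<times> bool \<Rightarrow> pvar"
  assumes fr_inj: "inj fr" and fr_fresh: "fr z \<notin> X"
begin

text \<open>Each token occurs with both values of the index \<open>i\<close>, so no term newly presented at a moment is
  presented at all histories through it.\<close>

definition direct :: "'ag form \<Rightarrow> bool \<Rightarrow> pol" where
  "direct A i = PVar (fr (A, True, i))"

definition delayed :: "'ag form \<Rightarrow> bool \<Rightarrow> pol" where
  "delayed A i = PVar (fr (A, False, i))"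

lemma direct_delayed_simps [simp]:
  "direct A i = direct B k \<longleftrightarrow> A = B \<and> i = k"
  "delayed A i = delayed B k \<longleftrightarrow> A = B \<and> i = k"
  "direct A i \<noteq> delayed B k" "delayed B k \<noteq> direct A i"
  using inj_eq[OF fr_inj] by (auto simp: direct_def delayed_def)

text \<open>Terms over \<open>X\<close> have the evidence stated in \<open>S\<close>. Composite
  terms with other variables are evidence for everything, which makes the closure conditions trivial
  for them; they are never presented and do not occur in formulas over \<open>X\<close>.\<close>

definition ev :: "'ag form set \<Rightarrow> pol \<Rightarrow> 'ag form set" where
  "ev S t =
    (if pvars_pol t \<subseteq> X then {A. t \<^bold>: A \<in> S}
     else case t of
       PVar x \<Rightarrow> {A. (\<exists>i. t = direct A i) \<or> (\<exists>i. t = delayed A i \<and> Proven A \<in> S)}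
     | _ \<Rightarrow> UNIV)"

lemma ev_X: "pvars_pol t \<subseteq> X \<Longrightarrow> ev S t = {A. t \<^bold>: A \<in> S}"
  by (simp add: ev_def)

lemma ev_UNIV: "\<not> pvars_pol t \<subseteq> X \<Longrightarrow> (\<And>x. t \<noteq> PVar x) \<Longrightarrow> ev S t = UNIV"
  by (simp add: ev_def split: pol.split)

lemma ev_direct [simp]: "ev S (direct A i) = {A}"
  using inj_eq[OF fr_inj] by (auto simp: ev_def direct_def delayed_def fr_fresh)

lemma ev_delayed [simp]: "ev S (delayed A i) = {B. B = A \<and> Proven A \<in> S}"
  using inj_eq[OF fr_inj] by (auto simp: ev_def direct_def delayed_def fr_fresh)

text \<open>Evidence depends on \<open>S\<close> only through formulas \<open>Just t A\<close> and
  \<open>Proven A\<close>; both imply their own knowledge and so pass to \<open>S'\<close>.\<close>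

lemma ev_mono:
  assumes S: "closed_theory S" and sub: "boxed Know S \<subseteq> S'"
  shows "ev S t \<subseteq> ev S' t"
proof -
  have "A \<in> S'" if "A \<in> S" "\<turnstile> A \<^bold>\<rightarrow> \<^bold>K A" for A
    using closed_theory_imp[OF S that(2,1)] sub by (auto simp: boxed_def)
  from this[OF _ provable_Just_Know] this[OF _ provable_Proven_Know]
  show ?thesis
    by (auto simp: ev_def split: pol.splits)
qed

lemma ev_closed:
  assumes S: "closed_theory S"
  shows "A \<^bold>\<rightarrow> B \<in> ev S s \<Longrightarrow> A \<in> ev S t \<Longrightarrow> B \<in> ev S (s \<^bold>\<times> t)"
    and "ev S s \<union> ev S t \<subseteq> ev S (s \<^bold>+ t)"
    and "A \<in> ev S t \<Longrightarrow> t \<^bold>: A \<in> ev S (\<^bold>! t)"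
proof -
  show "B \<in> ev S (s \<^bold>\<times> t)" if "A \<^bold>\<rightarrow> B \<in> ev S s" "A \<in> ev S t"
  proof (cases "pvars_pol (s \<^bold>\<times> t) \<subseteq> X")
    case True
    then have "s \<^bold>: (A \<^bold>\<rightarrow> B) \<in> S" "t \<^bold>: A \<in> S"
      using that by (simp_all add: ev_X)
    then have "(s \<^bold>\<times> t) \<^bold>: B \<in> S"
      by (intro closed_theory_mp[OF S closed_theory_imp[OF S Ax[OF A4]]])
    then show ?thesis using True by (simp add: ev_X)
  qed (simp add: ev_UNIV del: pvars_pol.simps)
  show "ev S s \<union> ev S t \<subseteq> ev S (s \<^bold>+ t)"
  proof (cases "pvars_pol (s \<^bold>+ t) \<subseteq> X")
    case True
    have "(s \<^bold>+ t) \<^bold>: A \<in> S" if "s \<^bold>: A \<in> S \<or> t \<^bold>: A \<in> S" for A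
    proof -
      have "s \<^bold>: A \<^bold>\<or> t \<^bold>: A \<in> S"
        using that closed_theory_taut1[OF S, of "s \<^bold>: A" "s \<^bold>: A \<^bold>\<or> t \<^bold>: A"]
          closed_theory_taut1[OF S, of "t \<^bold>: A" "s \<^bold>: A \<^bold>\<or> t \<^bold>: A"] by auto
      then show ?thesis by (rule closed_theory_imp[OF S Ax[OF A6]])
    qed
    then show ?thesis using True by (auto simp: ev_X)
  qed (simp add: ev_UNIV del: pvars_pol.simps)
  show "t \<^bold>: A \<in> ev S (\<^bold>! t)" if "A \<in> ev S t"
  proof (cases "pvars_pol (\<^bold>! t) \<subseteq> X")
    case True
    then have "t \<^bold>: A \<in> S" using that by (simp add: ev_X)
    then have "(\<^bold>! t) \<^bold>: (t \<^bold>: A) \<^bold>\<and> \<^bold>K A \<in> S"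
      by (rule closed_theory_imp[OF S Ax[OF A5]])
    then have "(\<^bold>! t) \<^bold>: (t \<^bold>: A) \<in> S"
      by (rule closed_theory_taut1[OF S]) simp
    then show ?thesis using True by (simp add: ev_X)
  qed (simp add: ev_UNIV del: pvars_pol.simps)
qed

lemma ev_axiom: "closed_theory S \<Longrightarrow> axiom_inst A \<Longrightarrow> A \<in> ev S (PConst c)"
  by (simp add: ev_X closed_theory_provable R3)

section \<open>Variables presented along a list of choices\<close>

definition presented :: "'ag form set \<Rightarrow> pol set" where
  "presented b = {direct A (idx b) |A. \<exists>j. Prove j A \<in> nu b} \<union>
    {delayed A (idx b) |A. Proven A \<in> succ (nu b)}"

text \<open>\<open>Act\<close> at \<open>{w}\<close> will be the board of \<open>w\<close> extended
  by the choice of the history. The first token presents its proven formulas under both indices, so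
  that its board can include that of any moment whose proven formulas it contains.\<close>

primrec board :: "'ag form set list \<Rightarrow> pol set" where
  "board [] = {}"
| "board (b # w) =
    (if w = [] then {direct A i |A i. Proven A \<in> nu b} \<union> {delayed A i |A i. Proven A \<in> nu b}
     else board w \<union> presented b)"

lemma board_mono: "suffix v w \<Longrightarrow> board v \<subseteq> board w"
  by (induction w) (auto simp: suffix_Cons)

lemma board_form: "t \<in> board w \<Longrightarrow> \<exists>A i. t = direct A i \<or> t = delayed A i"
  by (induction w) (auto simp: presented_def split: if_splits)

lemma Proven_boxed: "closed_theory S \<Longrightarrow> Proven A \<in> S \<Longrightarrow> Proven A \<in> boxed Know S"
  using closed_theory_imp[OF _ provable_Proven_Know] by (simp add: boxed_def)

text \<open>For variables presented by the front token this comes from the definition of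
  \<open>succ\<close>; for older ones \<open>Proven A\<close> persists because it is known.\<close>

lemma board_Proven:
  "valid w \<Longrightarrow> w \<noteq> [] \<Longrightarrow> direct A i \<in> board w \<or> delayed A i \<in> board w \<Longrightarrow> Proven A \<in> rep w"
proof (induction w)
  case (Cons b w)
  show ?case
  proof (cases "w = []")
    case True
    then show ?thesis using Cons.prems(3) by auto
  next
    case False
    have "Proven A \<in> rep (b # w)" if "direct A i \<in> board w \<or> delayed A i \<in> board w"
    proof -
      have "Proven A \<in> rep w" using Cons False that by simp
      then show ?thesis
        using Proven_boxed[OF closed_rep] rep_step[OF Cons.prems(1)] Cons.prems(1) by auto
    qed
    moreover have "Proven A \<in> rep (b # w)" if "direct A i \<in> presented b \<or> delayed A i \<in> presented b"
      using that succ(3) Cons.prems(1) by (auto simp: presented_def rep_Cons[OF False])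
    ultimately show ?thesis
      using Cons.prems(3) False by auto
  qed
qed simp

lemma Proven_board:
  assumes "Proven A \<in> rep w" "w \<noteq> []"
  shows "\<exists>i. delayed A i \<in> board w"
  using assms by (cases w rule: rep.cases) (auto simp: presented_def)

text \<open>Lets a new branch directly above the root be accessible from \<open>w\<close>: it starts
  with all variables on the board of \<open>w\<close>.\<close>

lemma board_subset:
  assumes "valid w" "mcs S" "\<And>A. w \<noteq> [] \<Longrightarrow> Proven A \<in> rep w \<Longrightarrow> Proven A \<in> S"
  shows "board w \<subseteq> board [token S i]"
proof (cases "w = []")
  case False
  have "t \<in> board [token S i]" if t: "t \<in> board w" for t
  proof -
    obtain A k where A: "t = direct A k \<or> t = delayed A k" using board_form[OF t] by blast
    then have "Proven A \<in> S"
      using board_Proven[OF assms(1) False, of A k] t assms(3)[OF False] by blast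
    then show ?thesis using A by (auto simp: token assms(2))
  qed
  then show ?thesis by blast
qed simp

section \<open>The canonical structure and its histories\<close>

definition key :: "'ag \<Rightarrow> 'ag form set list \<Rightarrow> 'ag form set list set set \<Rightarrow> 'ag form set" where
  "key j w h = (if w = [] then {} else boxed (Stit j) (nu (step h w)))"

text \<open>\<open>Choice\<close> and \<open>Val\<close> refer to histories, which depend only on
  \<open>Tree\<close> and \<open>Le\<close>; so histories are first taken from this structure. The
  board inclusion in \<open>Rel\<close> provides the persistence of shared proofs, and the last
  clause keeps the root inaccessible from other moments.\<close>

definition frame :: "('ag form set list set, 'ag) jstit_structure" where
  "frame = \<lparr>Tree = (\<lambda>w. {w}) ` {w. valid w},
    Le = {({v}, {w}) |v w. v \<in> {w. valid w} \<and> w \<in> {w. valid w} \<and> suffix v w},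
    Choice = \<lambda>_ _. {}, Act = \<lambda>_ _. {},
    Rel = {({v}, {w}) |v w. valid v \<and> valid w \<and> boxed Know (rep v) \<subseteq> rep w \<and>
      board v \<subseteq> board w \<and> (w = [] \<longrightarrow> v = [])},
    Evid = \<lambda>m. ev (rep (the_elem m)), Val = \<lambda>_. {}\<rparr>"

definition canon :: "('ag form set list set, 'ag) jstit_structure" where
  "canon = frame\<lparr>
    Choice := \<lambda>m j. (\<lambda>h. {h' \<in> HistAt frame m. key j (the_elem m) h' = key j (the_elem m) h}) `
      HistAt frame m,
    Act := \<lambda>m h. board (step h (the_elem m) # the_elem m),
    Val := \<lambda>p. {(m, h). m \<in> Tree frame \<and> h \<in> HistAt frame m \<and>
      Atom p \<in> nu (step h (the_elem m))}\<rparr>"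

lemma HistAt_frame: "HistAt frame m = HistAt canon m"
  by (simp add: HistAt_def Hist_def canon_def)

lemma canon_simps:
  "Tree canon = (\<lambda>w. {w}) ` {w. valid w}"
  "Le canon = {({v}, {w}) |v w. v \<in> {w. valid w} \<and> w \<in> {w. valid w} \<and> suffix v w}"
  "Act canon {w} h = board (step h w # w)"
  "Rel canon = {({v}, {w}) |v w. valid v \<and> valid w \<and> boxed Know (rep v) \<subseteq> rep w \<and>
      board v \<subseteq> board w \<and> (w = [] \<longrightarrow> v = [])}"
  "Evid canon {w} = ev (rep w)"
  by (simp_all add: canon_def frame_def)

lemma Choice_canon:
  "Choice canon {w} j =
    (\<lambda>h. {h' \<in> HistAt canon {w}. key j w h' = key j w h}) ` HistAt canon {w}"
  unfolding HistAt_frame[symmetric] by (simp add: canon_def)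

lemma Val_canon: "Val canon p = {(m, h) \<in> MH canon. Atom p \<in> nu (step h (the_elem m))}"
proof -
  have "Tree canon = Tree frame" by (simp add: canon_def)
  then show ?thesis
    unfolding MH_def HistAt_frame[symmetric] by (auto simp: canon_def)
qed

sublocale list_tree "{w. valid w}" canon
proof
  show "w \<in> {w. valid w}" if "b # w \<in> {w. valid w}" for b and w :: "'ag form set list"
    using that by simp
  show "\<exists>b. b # w \<in> {w. valid w}" if "w \<in> {w. valid w}" for w :: "'ag form set list"
  proof (cases "w = []")
    case True
    obtain S :: "'ag form set" where "mcs S" using mcs_without_Proven by blast
    then show ?thesis using True rep_token[of S "[]"] by auto
  next
    case False
    then show ?thesis using rep_token[of "rep w" w] mcs_rep[of w] that by auto
  qed
qed (simp_all only: canon_simps)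

lemma token_history:
  assumes "valid w" "mcs S" "w \<noteq> [] \<Longrightarrow> boxed Box S = boxed Box (rep w)"
  shows "\<exists>h\<in>HistAt canon {w}. step h w = token S i"
  using HistAt_exists rep_token[of S w i] assms by blast

lemma step_valid: "h \<in> HistAt canon {w} \<Longrightarrow> valid (step h w # w)"
  using step_in_W by simp

lemma step_mcs: "h \<in> HistAt canon {w} \<Longrightarrow> mcs (nu (step h w))"
  using step_valid by fastforce

lemma step_class:
  "h \<in> HistAt canon {w} \<Longrightarrow> w \<noteq> [] \<Longrightarrow> boxed Box (nu (step h w)) = boxed Box (rep w)"
  using step_valid by fastforce

lemma HistAt_nonempty: "valid w \<Longrightarrow> HistAt canon {w} \<noteq> {}"
  using W_extend[of w] HistAt_exists by blast

text \<open>Away from the root, the two tokens of \<open>rep w\<close> present disjoint sets of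
  variables. At the root, a token without any \<open>Proven A\<close> presents nothing. The
  conditions on shared proofs and the clause for \<open>Proven\<close> reduce to this
  equation.\<close>

lemma Inter_board:
  assumes w: "valid w"
  shows "(\<Inter>h\<in>HistAt canon {w}. board (step h w # w)) = board w"
proof
  show "board w \<subseteq> (\<Inter>h\<in>HistAt canon {w}. board (step h w # w))"
    using board_mono[OF suffix_ConsI[OF suffix_order.refl]] by blast
  show "(\<Inter>h\<in>HistAt canon {w}. board (step h w # w)) \<subseteq> board w"
  proof (cases "w = []")
    case True
    obtain S :: "'ag form set" where S: "mcs S" "\<forall>A. Proven A \<notin> S"
      using mcs_without_Proven by blast
    obtain h where "h \<in> HistAt canon {w}" "step h w = token S False"
      using token_history[OF w S(1)] True by blast
    moreover from this have "board (step h w # w) = {}"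
      using S True by (simp add: token)
    ultimately show ?thesis by blast
  next
    case False
    obtain h h' where h: "h \<in> HistAt canon {w}" "step h w = token (rep w) False"
      and h': "h' \<in> HistAt canon {w}" "step h' w = token (rep w) True"
      using token_history[OF w mcs_rep[OF w False]] by metis
    have "presented (step h w) \<inter> presented (step h' w) = {}"
      using h(2) h'(2) mcs_rep[OF w False] by (auto simp: presented_def token)
    then have "board (step h w # w) \<inter> board (step h' w # w) \<subseteq> board w"
      using False by auto
    then show ?thesis using h(1) h'(1) by blast
  qed
qed

section \<open>Verification of the conditions on jstit models\<close>

lemma undivided:
  assumes h: "h \<in> HistAt canon {v}" "h' \<in> HistAt canon {v}"
    and m: "m \<in> h \<inter> h'" "({v}, m) \<in> Lt canon"
  shows "step h v = step h' v"
proof -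
  obtain w where w: "m = {w}" "strict_suffix v w"
    using m(2) by (auto simp: Lt_def Le strict_suffix_def)
  then obtain b where "suffix (b # v) w" using strict_suffix_Cons by blast
  then show ?thesis
    using step_suffix[of _ w b v] h m(1) w(1) unfolding HistAt_def by auto
qed

lemma canon_cell:
  assumes "h \<in> HistAt canon {w}"
  shows "cell canon {w} j h = {h' \<in> HistAt canon {w}. key j w h' = key j w h}"
  unfolding cell_def using assms by (intro the_equality) (auto simp: Choice_canon)

lemma canon_Rel_iff:
  "({v}, {w}) \<in> Rel canon \<longleftrightarrow> valid v \<and> valid w \<and> boxed Know (rep v) \<subseteq> rep w \<and>
      board v \<subseteq> board w \<and> (w = [] \<longrightarrow> v = [])"
  by (auto simp: canon_simps)

lemma canon_RelE:
  assumes "(m, m') \<in> Rel canon"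
  obtains v w where "m = {v}" "m' = {w}" "valid v" "valid w" "boxed Know (rep v) \<subseteq> rep w"
    "board v \<subseteq> board w" "w = [] \<longrightarrow> v = []"
  using assms unfolding canon_simps by blast

lemma canon_preorder: "preorder_on (Tree canon) (Rel canon)"
proof -
  have "Rel canon \<subseteq> Tree canon \<times> Tree canon" by (auto simp: canon_simps)
  moreover have "refl_on (Tree canon) (Rel canon)"
    using Know_boxed_refl[OF closed_rep] by (auto simp: refl_on_def canon_simps)
  moreover have "trans (Rel canon)"
  proof (rule transI)
    fix m m' m''
    assume R: "(m, m') \<in> Rel canon" "(m', m'') \<in> Rel canon"
    obtain u v where "m = {u}" "m' = {v}" using R(1) by (rule canon_RelE)
    moreover obtain w where "m'' = {w}" using R(2) by (rule canon_RelE)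
    ultimately show "(m, m'') \<in> Rel canon"
      using R Know_boxed_trans[OF closed_rep, of u "rep v" "rep w"] by (auto simp: canon_Rel_iff)
  qed
  ultimately show ?thesis by (simp add: preorder_on_def)
qed

text \<open>At the root \<open>key\<close> is constant, so every agent has a single cell; elsewhere
  the independence of agents for maximal consistent sets provides the token of a common
  history.\<close>

lemma canon_independent:
  assumes w: "valid w" and f: "\<And>j. f j \<in> Choice canon {w} j"
  shows "(\<Inter>j. f j) \<noteq> {}"
proof -
  have "\<forall>j. \<exists>h. h \<in> HistAt canon {w} \<and> f j = {h' \<in> HistAt canon {w}. key j w h' = key j w h}"
    using f by (simp add: Choice_canon image_iff Bex_def)
  from choice[OF this] obtain g where g: "\<And>j. g j \<in> HistAt canon {w}"
      "\<And>j. f j = {h' \<in> HistAt canon {w}. key j w h' = key j w (g j)}"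
    by blast
  show ?thesis
  proof (cases "w = []")
    case True
    then show ?thesis using g by (auto simp: key_def)
  next
    case False
    obtain S where S: "mcs S" "boxed Box S = boxed Box (rep w)"
        "\<And>j. boxed (Stit j) S = boxed (Stit j) (nu (step (g j) w))"
      using agents_independent[OF mcs_rep[OF w False], of "\<lambda>j. nu (step (g j) w)",
          OF step_mcs[OF g(1)] step_class[OF g(1) False]]
      by blast
    obtain h where h: "h \<in> HistAt canon {w}" "step h w = token S False"
      using token_history[OF w S(1,2)] by blast
    have "h \<in> f j" for j
      using h S unfolding g(2) by (simp add: key_def False token)
    then show ?thesis by blast
  qed
qed

lemma canon_jstit_model: "jstit_model canon"
  unfolding jstit_model_def
proof (intro conjI)
  show "Tree canon \<noteq> {}"
    using valid.simps(1) unfolding canon_simps by blast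
  show "partial_order_on (Tree canon) (Le canon)" by (rule po)
  show "\<forall>m\<in>Tree canon. \<forall>j. partition_on (HistAt canon m) (Choice canon m j)"
    by (auto simp: Tree Choice_canon partition_on_def disjoint_def)
  show "preorder_on (Tree canon) (Rel canon)" by (rule canon_preorder)
  show "\<forall>p. Val canon p \<subseteq> MH canon" by (auto simp: Val_canon)
  show "\<forall>m\<in>Tree canon. \<forall>m'\<in>Tree canon. \<exists>m0\<in>Tree canon. (m0, m) \<in> Le canon \<and> (m0, m') \<in> Le canon"
    by (intro ballI bexI[of _ "{[]}"]) (auto simp: Tree Le_iff)
  show "\<forall>m\<in>Tree canon. \<forall>m1\<in>Tree canon. \<forall>m2\<in>Tree canon.
      (m1, m) \<in> Le canon \<longrightarrow> (m2, m) \<in> Le canon \<longrightarrow> (m1, m2) \<in> Le canon \<or> (m2, m1) \<in> Le canon"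
    using linear by blast
  show "\<forall>m\<in>Tree canon. \<forall>m'\<in>Tree canon. \<forall>h\<in>HistAt canon m. \<forall>h'\<in>HistAt canon m. \<forall>j.
      (m, m') \<in> Lt canon \<longrightarrow> m' \<in> h \<inter> h' \<longrightarrow> cell canon m j h = cell canon m j h'"
    using undivided by (auto simp: Tree canon_cell key_def)
  show "\<forall>m\<in>Tree canon. \<forall>f. (\<forall>j. f j \<in> Choice canon m j) \<longrightarrow> (\<Inter>j. f j) \<noteq> {}"
    using canon_independent by (simp add: Tree)
  show "\<forall>m m' t. (m, m') \<in> Rel canon \<longrightarrow> Evid canon m t \<subseteq> Evid canon m' t"
    by (intro allI impI, erule canon_RelE) (simp add: canon_simps(5) ev_mono closed_rep)
  show "\<forall>m\<in>Tree canon. \<forall>s t A B.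
      (A \<^bold>\<rightarrow> B \<in> Evid canon m s \<longrightarrow> A \<in> Evid canon m t \<longrightarrow> B \<in> Evid canon m (s \<^bold>\<times> t)) \<and>
      Evid canon m s \<union> Evid canon m t \<subseteq> Evid canon m (s \<^bold>+ t) \<and>
      (A \<in> Evid canon m t \<longrightarrow> t \<^bold>: A \<in> Evid canon m (\<^bold>! t))"
    using ev_closed[OF closed_rep] by (simp add: Tree canon_simps(5))
  show "\<forall>m\<in>Tree canon. \<forall>m'\<in>Tree canon. (m', m) \<in> Lt canon \<longrightarrow>
      (\<forall>h\<in>HistAt canon m. Act canon m' h \<subseteq> Act canon m h)"
  proof -
    have "board (step h v # v) \<subseteq> board (step h w # w)"
      if "strict_suffix v w" "h \<in> HistAt canon {w}" for v w h
    proof -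
      obtain b where b: "suffix (b # v) w" using strict_suffix_Cons[OF \<open>strict_suffix v w\<close>] by blast
      show ?thesis
        using board_mono[OF suffix_ConsI[OF b]] step_suffix[OF \<open>h \<in> _\<close> b] by simp
    qed
    then show ?thesis by (simp add: Tree Lt_iff canon_simps(3))
  qed
  show "\<forall>m\<in>Tree canon. (\<Inter>h\<in>HistAt canon m. Act canon m h) \<subseteq>
      (\<Union>m'\<in>{m' \<in> Tree canon. (m', m) \<in> Lt canon}. \<Union>h\<in>HistAt canon m. Act canon m' h)"
  proof
    fix m assume "m \<in> Tree canon"
    then obtain w where w: "m = {w}" "valid w" by (auto simp: Tree)
    show "(\<Inter>h\<in>HistAt canon m. Act canon m h) \<subseteq>
      (\<Union>m'\<in>{m' \<in> Tree canon. (m', m) \<in> Lt canon}. \<Union>h\<in>HistAt canon m. Act canon m' h)"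
    proof (cases w)
      case Nil
      then show ?thesis using Inter_board[OF w(2)] w(1) by (simp add: canon_simps(3))
    next
      case (Cons b v)
      obtain h where h: "h \<in> HistAt canon {w}" using HistAt_nonempty[OF w(2)] by blast
      have v: "valid v" using w(2) Cons by simp
      have "step h v = b" using step_suffix[OF h, of b v] Cons by simp
      \<comment> \<open>The shared proofs at \<open>b # v\<close> form its board, and this is also
        \<open>Act\<close> at the predecessor \<open>{v}\<close> along \<open>h\<close>, since
        \<open>h\<close> chooses \<open>b\<close> there.\<close>
      then have "(\<Inter>h\<in>HistAt canon m. Act canon m h) = Act canon {v} h"
        using Inter_board[OF w(2)] w(1) Cons by (simp add: canon_simps(3))
      moreover have "{v} \<in> Tree canon" "({v}, m) \<in> Lt canon"
        using v w Cons by (simp_all add: Tree Lt_iff strict_suffix_def suffix_Cons)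
      ultimately show ?thesis using h w(1) by blast
    qed
  qed
  show "\<forall>m\<in>Tree canon. \<forall>h\<in>HistAt canon m. \<forall>h'\<in>HistAt canon m.
      (\<exists>m'\<in>h \<inter> h'. (m, m') \<in> Lt canon) \<longrightarrow> Act canon m h = Act canon m h'"
  proof (intro ballI impI)
    fix m h h'
    assume "m \<in> Tree canon" and h: "h \<in> HistAt canon m" "h' \<in> HistAt canon m"
      and "\<exists>m'\<in>h \<inter> h'. (m, m') \<in> Lt canon"
    then obtain v m' where v: "m = {v}" and m': "m' \<in> h \<inter> h'" "({v}, m') \<in> Lt canon"
      unfolding Tree by blast
    then have "step h v = step h' v"
      using undivided[of h v h' m'] h by simp
    then show "Act canon m h = Act canon m h'"
      by (simp add: v canon_simps(3))
  qed
  show "Le canon \<subseteq> Rel canon"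
  proof
    fix z assume "z \<in> Le canon"
    then obtain v w where vw: "z = ({v}, {w})" "valid v" "valid w" "suffix v w"
      unfolding Le by blast
    then show "z \<in> Rel canon"
      using rep_suffix[OF vw(4,3)] board_mono[OF vw(4)] by (auto simp: canon_Rel_iff)
  qed
  \<comment> \<open>By \<open>Inter_board\<close> the shared proofs are the boards, whose inclusion
    is part of \<open>Rel\<close>.\<close>
  show "\<forall>m m'. (m, m') \<in> Rel canon \<longrightarrow>
      (\<Inter>h\<in>HistAt canon m. Act canon m h) \<subseteq> (\<Inter>h'\<in>HistAt canon m'. Act canon m' h')"
    by (intro allI impI, erule canon_RelE) (simp only: canon_simps(3) Inter_board)
qed

lemma canon_normal: "normal canon"
  using ev_axiom[OF closed_rep] by (simp add: normal_def Tree canon_simps(5))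

section \<open>The truth lemma\<close>

lemma truth_knows:
  assumes P: "\<And>w h. valid w \<Longrightarrow> w \<noteq> [] \<Longrightarrow> h \<in> HistAt canon {w} \<Longrightarrow> P {w} h \<longleftrightarrow> A \<in> nu (step h w)"
    and w: "valid w" "w \<noteq> []"
  shows "knows canon P {w} \<longleftrightarrow> \<^bold>K A \<in> rep w"
proof
  assume KA: "\<^bold>K A \<in> rep w"
  have "A \<in> nu (step h v)"
    if v: "valid v" "v \<noteq> []" "boxed Know (rep w) \<subseteq> rep v" and h: "h \<in> HistAt canon {v}" for v h
  proof -
    \<comment> \<open>A8 strengthens \<open>K A\<close> to knowledge of box \<open>A\<close>, so
      that \<open>A\<close> reaches every member of the box class at \<open>v\<close>, not only
      \<open>rep v\<close>.\<close>
    have "A \<in> boxed Box (rep v)"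
      using Know_Know_Box[OF closed_rep[OF w(1)] KA] v(3) by (auto simp: boxed_def)
    then show ?thesis
      using step_class[OF h v(2)] s5_boxed_refl[OF step_mcs[OF h] s5_Box] by blast
  qed
  then show "knows canon P {w}"
    using P w(2) unfolding knows_def by (auto elim!: canon_RelE)
next
  assume K: "knows canon P {w}"
  show "\<^bold>K A \<in> rep w"
  proof (rule ccontr)
    assume "\<^bold>K A \<notin> rep w"
    then obtain S where S: "mcs S" "boxed Know (rep w) \<subseteq> S" "A \<notin> S"
      using normal_op_witness[OF mcs_rep[OF w] normal_Know] by blast
    \<comment> \<open>The witness is a new branch directly above the root, where the label is the
      chosen set \<open>S\<close> itself and not its \<open>succ\<close>.\<close>
    let ?v = "[token S False]"
    have v: "valid ?v" "rep ?v = S" using S(1) by (simp_all add: token)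
    have "\<exists>h\<in>HistAt canon {?v}. step h ?v = token S False"
      by (rule token_history[OF v(1) S(1)]) (simp only: v(2))
    then obtain h where h: "h \<in> HistAt canon {?v}" "step h ?v = token S False"
      by blast
    have "board w \<subseteq> board ?v"
      using board_subset[OF w(1) S(1)] Proven_boxed[OF closed_rep[OF w(1)]] S(2) by blast
    then have "({w}, {?v}) \<in> Rel canon"
      using w S v by (simp add: canon_Rel_iff)
    then have "P {?v} h" using K h(1) unfolding knows_def by blast
    then show False using P[OF v(1) _ h(1)] h(2) S by (simp add: token)
  qed
qed

text \<open>In the induction \<open>P\<close> is satisfaction of \<open>A\<close>. It is kept
  arbitrary so that the cases for \<open>Just\<close>, \<open>Prove\<close> and
  \<open>Proven\<close> can share this equivalence before the truth lemma is available.\<close>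

lemma truth_justified:
  assumes P: "\<And>w h. valid w \<Longrightarrow> w \<noteq> [] \<Longrightarrow> h \<in> HistAt canon {w} \<Longrightarrow> P {w} h \<longleftrightarrow> A \<in> nu (step h w)"
    and w: "valid w" "w \<noteq> []"
  shows "justified canon t A P {w} \<longleftrightarrow> A \<in> ev (rep w) t \<and> \<^bold>K A \<in> rep w"
proof -
  have "knows canon P {w} \<longleftrightarrow> \<^bold>K A \<in> rep w"
    by (rule truth_knows) (simp_all add: P w)
  then show ?thesis by (simp add: justified_def canon_simps(5))
qed

lemma step_Know:
  assumes "h \<in> HistAt canon {w}" "valid w" "w \<noteq> []" "\<turnstile> A \<^bold>\<rightarrow> \<^bold>K A"
  shows "A \<in> nu (step h w) \<longleftrightarrow> A \<in> rep w"
  using Box_class_Know_imp[OF step_mcs mcs_rep step_class] assms by blast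

text \<open>A variable on the board is evidence at most for its own formula, which is proven by
  \<open>board_Proven\<close>. Conversely, a proven formula has a delayed variable on the board, and
  it is evidence exactly because \<open>Proven A\<close> holds.\<close>

lemma board_evidence:
  assumes "valid w" "w \<noteq> []"
  shows "(\<exists>t\<in>board w. A \<in> ev (rep w) t \<and> \<^bold>K A \<in> rep w) \<longleftrightarrow> Proven A \<in> rep w"
proof
  assume "\<exists>t\<in>board w. A \<in> ev (rep w) t \<and> \<^bold>K A \<in> rep w"
  then obtain t where t: "t \<in> board w" "A \<in> ev (rep w) t" by blast
  obtain B i where "t = direct B i \<or> t = delayed B i" using board_form[OF t(1)] by blast
  then show "Proven A \<in> rep w"
    using t board_Proven[OF assms, of A i] by auto
next
  assume A: "Proven A \<in> rep w"
  then obtain i where "delayed A i \<in> board w" using Proven_board assms(2) by blast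
  moreover have "\<^bold>K A \<in> rep w"
    using closed_theory_imp[OF closed_rep[OF assms(1)] Ax[OF A11] A]
    by (rule closed_theory_taut1[OF closed_rep[OF assms(1)]]) simp
  ultimately show "\<exists>t\<in>board w. A \<in> ev (rep w) t \<and> \<^bold>K A \<in> rep w"
    using A by force
qed

lemma truth_Proven:
  assumes w: "valid w" "w \<noteq> []"
  shows "(\<exists>t. \<forall>h\<in>HistAt canon {w}. t \<in> Act canon {w} h \<and> A \<in> ev (rep w) t \<and> \<^bold>K A \<in> rep w) \<longleftrightarrow>
    Proven A \<in> rep w"
proof -
  have "(\<forall>h\<in>HistAt canon {w}. t \<in> Act canon {w} h) \<longleftrightarrow> t \<in> board w" for t
    using Inter_board[OF w(1)] unfolding canon_simps(3) by blast
  then show ?thesis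
    using board_evidence[OF w, of A] HistAt_nonempty[OF w(1)] by blast
qed

text \<open>Absence of \<open>Proven A\<close> stands for the second clause of \<open>Prove\<close>.
  If \<open>Prove j A\<close> is chosen, A9 spreads it over the cell, and every history there
  presents a direct variable for \<open>A\<close>. If not, A13 yields a history in the cell on which
  nobody proves \<open>A\<close>.\<close>

lemma truth_Prove:
  assumes w: "valid w" "w \<noteq> []" and h: "h \<in> HistAt canon {w}"
  shows "(\<forall>h'\<in>cell canon {w} j h. \<exists>t\<in>Act canon {w} h'. A \<in> ev (rep w) t \<and> \<^bold>K A \<in> rep w) \<and>
      Proven A \<notin> rep w \<longleftrightarrow> Prove j A \<in> nu (step h w)" (is "?L \<and> _ \<longleftrightarrow> ?R")
proof -
  let ?S = "nu (step h w)"
  note S = step_mcs[OF h]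
  have Proven: "Proven A \<in> rep w \<longleftrightarrow> Proven A \<in> ?S"
    using step_Know[OF h w provable_Proven_Know] by blast
  have "?L \<and> Proven A \<notin> rep w" if ?R
  proof -
    have A9: "\<^bold>\<not> Proven A \<in> ?S" "\<^bold>[j\<^bold>] Prove j A \<in> ?S" "\<^bold>K A \<in> ?S"
      using mcs_imp[OF S Ax[OF A9] that] mcs_Conj[OF S] by blast+
    have K: "\<^bold>K A \<in> rep w"
      using Box_class_Know[OF S mcs_rep[OF w] step_class[OF h w(2)]] A9(3) by blast
    have "\<exists>t\<in>Act canon {w} h'. A \<in> ev (rep w) t" if h': "h' \<in> cell canon {w} j h" for h'
    proof -
      have h'': "h' \<in> HistAt canon {w}" "boxed (Stit j) (nu (step h' w)) = boxed (Stit j) ?S"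
        using h' w(2) by (auto simp: canon_cell[OF h] key_def)
      then have "Prove j A \<in> nu (step h' w)"
        using A9(2) s5_boxed_refl[OF step_mcs[OF h''(1)] s5_Stit] by (auto simp: boxed_def)
      then have "direct A (idx (step h' w)) \<in> Act canon {w} h'"
        using w(2) by (auto simp: canon_simps(3) presented_def)
      then show ?thesis by force
    qed
    then show ?thesis using K Proven A9(1) mcs_Neg[OF S] by blast
  qed
  moreover have ?R if L: ?L and nP: "Proven A \<notin> rep w"
  proof (rule ccontr)
    assume "\<not> ?R"
    then have "\<^bold>\<not> Prove j A \<in> ?S" using mcs_Neg[OF S] by blast
    from mcs_imp[OF S Ax[OF A13] this]
    have "\<^bold>[j\<^bold>] \<^bold>\<not> NobodyProves A \<notin> ?S" using mcs_Neg[OF S] by blast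
    then obtain S' where S': "mcs S'" "boxed (Stit j) ?S \<subseteq> S'" "\<^bold>\<not> NobodyProves A \<notin> S'"
      using normal_op_witness[OF S s5_normal[OF s5_Stit]] by blast
    have nobody: "Prove i A \<notin> S'" for i
      using S'(1,3) NobodyProves_mcs mcs_Neg by blast
    have "boxed Box S' = boxed Box (rep w)"
      using Stit_class_Box[OF S S'(1,2)] step_class[OF h w(2)] by simp
    then obtain h' where h': "h' \<in> HistAt canon {w}" "step h' w = token S' False"
      using token_history[OF w(1) S'(1)] by blast
    have "boxed (Stit j) ?S = boxed (Stit j) S'"
      by (rule s5_boxed_eq[OF S S'(1) s5_Stit S'(2)])
    then have "h' \<in> cell canon {w} j h"
      using h' by (simp add: canon_cell[OF h] key_def token S'(1))
    then obtain t where t: "t \<in> board w \<union> presented (step h' w)" "A \<in> ev (rep w) t" "\<^bold>K A \<in> rep w"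
      using L w(2) by (auto simp: canon_simps(3))
    have "t \<notin> board w"
      using board_evidence[OF w, of A] t(2,3) nP by blast
    then have "t \<in> presented (step h' w)" using t(1) by blast
    \<comment> \<open>A direct variable for \<open>A\<close> would require some
      \<open>Prove i A\<close> in \<open>S'\<close>, and a delayed one is evidence only if
      \<open>Proven A\<close> is in \<open>rep w\<close>.\<close>
    then show False
      using t(2) nP nobody by (auto simp: presented_def h'(2) token S'(1))
  qed
  ultimately show ?thesis by blast
qed

text \<open>Restricted to formulas over \<open>X\<close>, for whose terms evidence is read off
  \<open>rep w\<close>, and to moments other than the root, from which \<open>Rel\<close> never
  leads to the root.\<close>

lemma truth:
  assumes "pvars A \<subseteq> X" "valid w" "w \<noteq> []" "h \<in> HistAt canon {w}"
  shows "sat canon A {w} h \<longleftrightarrow> A \<in> nu (step h w)"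
  using assms
proof (induction A arbitrary: w h)
  case (Atom p)
  then show ?case by (auto simp: Val_canon MH_def Tree)
next
  case (Conj A B)
  then show ?case using mcs_Conj[OF step_mcs[OF Conj.prems(4)]] by simp
next
  case (Neg A)
  then show ?case using mcs_Neg[OF step_mcs[OF Neg.prems(4)]] by simp
next
  case (Stit j A)
  let ?S = "nu (step h w)"
  note S = step_mcs[OF Stit.prems(4)] and IH = Stit.IH[OF _ Stit.prems(2,3)]
  have "sat canon (\<^bold>[j\<^bold>] A) {w} h" if A: "\<^bold>[j\<^bold>] A \<in> ?S"
  proof -
    have "A \<in> nu (step h' w)"
      if "h' \<in> HistAt canon {w}" "boxed (Stit j) (nu (step h' w)) = boxed (Stit j) ?S" for h'
      using s5_boxed_refl[OF step_mcs[OF that(1)] s5_Stit] that(2) A by (auto simp: boxed_def)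
    then show ?thesis
      using IH Stit.prems(1,3) by (simp add: canon_cell[OF Stit.prems(4)] key_def)
  qed
  moreover have "\<not> sat canon (\<^bold>[j\<^bold>] A) {w} h" if "\<^bold>[j\<^bold>] A \<notin> ?S"
  proof -
    obtain S' where S': "mcs S'" "boxed (Stit j) ?S \<subseteq> S'" "A \<notin> S'"
      using normal_op_witness[OF S s5_normal[OF s5_Stit] \<open>\<^bold>[j\<^bold>] A \<notin> ?S\<close>] by blast
    have "boxed Box S' = boxed Box (rep w)"
      using Stit_class_Box[OF S S'(1,2)] step_class[OF Stit.prems(4,3)] by simp
    then obtain h' where h': "h' \<in> HistAt canon {w}" "step h' w = token S' False"
      using token_history[OF Stit.prems(2) S'(1)] by blast
    have "boxed (Stit j) ?S = boxed (Stit j) S'"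
      by (rule s5_boxed_eq[OF S S'(1) s5_Stit S'(2)])
    then have "h' \<in> cell canon {w} j h"
      using h' by (simp add: canon_cell[OF Stit.prems(4)] key_def token S'(1))
    moreover have "\<not> sat canon A {w} h'"
      using IH[OF _ h'(1)] Stit.prems(1) S'(3) h'(2) by (simp add: token S'(1))
    ultimately show ?thesis by auto
  qed
  ultimately show ?case by blast
next
  case (Box A)
  let ?S = "nu (step h w)"
  note S = step_mcs[OF Box.prems(4)] and IH = Box.IH[OF _ Box.prems(2,3)]
  note cls = step_class[OF _ Box.prems(3)]
  have "sat canon (\<^bold>\<box> A) {w} h" if A: "\<^bold>\<box> A \<in> ?S"
  proof -
    have "A \<in> nu (step h' w)" if "h' \<in> HistAt canon {w}" for h'
      using s5_boxed_refl[OF step_mcs[OF that] s5_Box] cls[OF that] cls[OF Box.prems(4)] A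
      by (auto simp: boxed_def)
    then show ?thesis using IH Box.prems(1) by simp
  qed
  moreover have "\<not> sat canon (\<^bold>\<box> A) {w} h" if "\<^bold>\<box> A \<notin> ?S"
  proof -
    obtain S' where S': "mcs S'" "boxed Box ?S \<subseteq> S'" "A \<notin> S'"
      using normal_op_witness[OF S s5_normal[OF s5_Box] \<open>\<^bold>\<box> A \<notin> ?S\<close>] by blast
    have "boxed Box S' = boxed Box (rep w)"
      using s5_boxed_eq[OF S S'(1) s5_Box S'(2)] cls[OF Box.prems(4)] by simp
    then obtain h' where h': "h' \<in> HistAt canon {w}" "step h' w = token S' False"
      using token_history[OF Box.prems(2) S'(1)] by blast
    then have "\<not> sat canon A {w} h'"
      using IH[OF _ h'(1)] Box.prems(1) S'(3) by (simp add: token S'(1))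
    then show ?thesis using h'(1) by auto
  qed
  ultimately show ?case by blast
next
  case (Just t A)
  have X: "pvars A \<subseteq> X" "pvars_pol t \<subseteq> X" using Just.prems(1) by auto
  have "justified canon t A (sat canon A) {w} \<longleftrightarrow> A \<in> ev (rep w) t \<and> \<^bold>K A \<in> rep w"
    by (rule truth_justified) (simp_all add: Just.IH X Just.prems)
  then have "sat canon (t \<^bold>: A) {w} h \<longleftrightarrow> t \<^bold>: A \<in> rep w \<and> \<^bold>K A \<in> rep w"
    by (simp add: ev_X[OF X(2)])
  also have "\<dots> \<longleftrightarrow> t \<^bold>: A \<in> rep w"
    using mcs_imp[OF mcs_rep[OF Just.prems(2,3)] Ax[OF A5]] mcs_Conj[OF mcs_rep[OF Just.prems(2,3)]]
    by blast
  also have "\<dots> \<longleftrightarrow> t \<^bold>: A \<in> nu (step h w)"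
    using step_Know[OF Just.prems(4,2,3) provable_Just_Know] by simp
  finally show ?case .
next
  case (Know A)
  have X: "pvars A \<subseteq> X" using Know.prems(1) by simp
  have "knows canon (sat canon A) {w} \<longleftrightarrow> \<^bold>K A \<in> rep w"
    by (rule truth_knows) (simp_all add: Know.IH X Know.prems)
  then show ?case
    using step_Know[OF Know.prems(4,2,3) Ax[OF A7_4]] by simp
next
  case (Prove j A)
  have X: "pvars A \<subseteq> X" using Prove.prems(1) by simp
  have just: "justified canon s A (sat canon A) {w} \<longleftrightarrow> A \<in> ev (rep w) s \<and> \<^bold>K A \<in> rep w" for s
    by (rule truth_justified) (simp_all add: Prove.IH X Prove.prems)
  have "(\<forall>s. \<exists>h''\<in>HistAt canon {w}. justified canon s A (sat canon A) {w} \<longrightarrow> s \<notin> Act canon {w} h'')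
      \<longleftrightarrow> Proven A \<notin> rep w"
    unfolding just using truth_Proven[OF Prove.prems(2,3), of A] HistAt_nonempty[OF Prove.prems(2)]
    by blast
  then show ?case
    using truth_Prove[OF Prove.prems(2-4), of j A] by (simp add: just)
next
  case (Proven A)
  have X: "pvars A \<subseteq> X" using Proven.prems(1) by simp
  have just: "justified canon s A (sat canon A) {w} \<longleftrightarrow> A \<in> ev (rep w) s \<and> \<^bold>K A \<in> rep w" for s
    by (rule truth_justified) (simp_all add: Proven.IH X Proven.prems)
  show ?case
    using truth_Proven[OF Proven.prems(2,3), of A]
      step_Know[OF Proven.prems(4,2,3) provable_Proven_Know] by (simp add: just)
qed

lemma canon_satisfiable:
  fixes \<Gamma> :: "'ag form set"
  assumes "mcs S" "\<Gamma> \<subseteq> S" "\<Gamma> \<subseteq> Form_over X"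
  shows "satisfiable TYPE('ag moment) \<Gamma>"
proof -
  let ?w = "[token S False]"
  have w: "valid ?w" "rep ?w = S" using assms(1) by (simp_all add: token)
  have "\<exists>h\<in>HistAt canon {?w}. step h ?w = token S False"
    by (rule token_history[OF w(1) assms(1)]) (simp only: w(2))
  then obtain h where h: "h \<in> HistAt canon {?w}" "step h ?w = token S False"
    by blast
  have "sat canon A {?w} h" if "A \<in> \<Gamma>" for A
    using truth[OF _ w(1) _ h(1), of A] that assms h(2) by (auto simp: Form_over_def token)
  moreover have "({?w}, h) \<in> MH canon"
    using h(1) w(1) by (simp add: MH_def Tree)
  ultimately show ?thesis
    unfolding satisfiable_def using canon_jstit_model canon_normal by blast
qed

end

text \<open>Completeness uses the fixed type \<open>'ag moment\<close>; soundness for an arbitrary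
  type \<open>'m\<close> then covers satisfiability in every normal model.\<close>

theorem theorem2:
  fixes X :: "pvar set" and \<Gamma> :: "'ag::finite form set"
  assumes "countable (UNIV - X)" and "infinite (UNIV - X)"
    and "\<Gamma> \<subseteq> Form_over X"
  shows "(consistent \<Gamma> \<longleftrightarrow> satisfiable TYPE('ag moment) \<Gamma>) \<and>
         (satisfiable TYPE('m) \<Gamma> \<longrightarrow> consistent \<Gamma>)"
proof -
  have "satisfiable TYPE('ag moment) \<Gamma>" if "consistent \<Gamma>"
  proof -
    have "\<not> entails \<Gamma> \<^bold>\<bottom>"
    proof
      assume "entails \<Gamma> \<^bold>\<bottom>"
      then obtain As where As: "set As \<subseteq> \<Gamma>" "\<turnstile> Conjs As \<^bold>\<rightarrow> \<^bold>\<bottom>"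
        unfolding entails_def by blast
      \<comment> \<open>\<open>inconsistent\<close> demands a nonempty list and
        \<open>entails\<close> does not; an empty one would make falsity a member of the maximal
        consistent set \<open>S\<close>.\<close>
      obtain S :: "'ag form set" where S: "mcs S" using mcs_without_Proven by blast
      have "As \<noteq> []"
        using mcs_imp[OF S As(2)] mcs_Bot[OF S] closed_theory_Conjs[OF mcs_closed[OF S], of As] by auto
      then show False
        using As that unfolding consistent_def inconsistent_def by blast
    qed
    from Lindenbaum[OF this] obtain S where S: "mcs S" "\<Gamma> \<subseteq> S" by blast
    \<comment> \<open>The numbering of formulas with two bits is followed by an enumeration of the
      infinite complement of \<open>X\<close>; both are injective, and the values avoid
      \<open>X\<close>.\<close>
    define fr :: "'ag form \<times> bool \<times> bool \<Rightarrow> pvar" where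
      "fr = from_nat_into (UNIV - X) \<circ> to_nat"
    have bij: "bij_betw (from_nat_into (UNIV - X)) UNIV (UNIV - X)"
      by (rule bij_betw_from_nat_into[OF assms(1,2)])
    interpret canonical X fr
    proof
      show "inj fr"
        unfolding fr_def using bij by (intro inj_compose) (auto simp: bij_betw_def)
      show "fr z \<notin> X" for z
        using bij_betwE[OF bij] by (simp add: fr_def)
    qed
    show ?thesis by (rule canon_satisfiable[OF S assms(3)])
  qed
  then show ?thesis
    by (blast intro: satisfiable_consistent)
qed

end
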